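(* For $A,B\in\mathrm{BARI}^{\mathrm{pol}}$, one has $$\mathrm{ganit}_{\mathrm{pic}}\Bigl(\mathrm{preari}\bigl(\mathrm{ganit}_{\mathrm{poc}}(A),\mathrm{ganit}_{\mathrm{poc}}(B)\bigr)\Bigr)=\mathrm{preuri}(A,B).$$ In particular, $$\mathrm{uri}(A,B)=\mathrm{preuri}(A,B)-\mathrm{preuri}(B,A).$$
   Context: **Bimoulds.** A bimould is a family $A=(A_r)_{r\ge0}$ with $A_r=A_r(X_1,\dots,X_r\mid Y_1,\dots,Y_r)\in\mathbb Q[[X_1,Y_1,\dots,X_r,Y_r]]$ (component of depth $r$); we also allow components in $\mathcal L_r=\mathbb Q[[X_1,Y_1,\dots,X_r,Y_r]]\left[\tfrac1{X_i},\tfrac1{X_i-X_j}\mid 1\le i\ne j\le r\right]$. $\mathrm{BARI}^{\mathrm{loc}}$ is the space of families with $A_0=0$, $A_r\in\mathcal L_r$. $\mathrm{BARI}^{\mathrm{pol}}$ is its subspace of families with polynomial components, only finitely many of them nonzero. A bimould is normalized if $A_0=1$. Write $Y_{a:b}=Y_a+\dots+Y_b$. **Flexion operations.** $\mathrm{mu}(A,B)_r=\sum_{i=0}^rA_i(X_1,\dots,X_i\mid Y_1,\dots,Y_i)\,B_{r-i}(X_{i+1},\dots,X_r\mid Y_{i+1},\dots,Y_r)$. For $B$ with $B_0=0$, $$\mathrm{amit}(B)(A)_r=\sum_{1\le a<b\le r}A_{r-b+a}(X_1,\dots,X_{a-1},X_b,X_{b+1},\dots,X_r\mid Y_1,\dots,Y_{a-1},Y_{a:b},Y_{b+1},\dots,Y_r)\,B_{b-a}(X_a-X_b,\dots,X_{b-1}-X_b\mid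 Y_a,\dots,Y_{b-1}),$$ $$\mathrm{anit}(B)(A)_r=\sum_{1\le a<b\le r}A_{r-b+a}(X_1,\dots,X_{a-1},X_a,X_{b+1},\dots,X_r\mid Y_1,\dots,Y_{a-1},Y_{a:b},Y_{b+1},\dots,Y_r)\,B_{b-a}(X_{a+1}-X_a,\dots,X_b-X_a\mid Y_{a+1},\dots,Y_b),$$ $\mathrm{arit}(B)=\mathrm{amit}(B)-\mathrm{anit}(B)$, $\mathrm{preari}(A,B)=\mathrm{arit}(B)(A)+\mathrm{mu}(A,B)$, $\mathrm{ari}(A,B)=\mathrm{preari}(A,B)-\mathrm{preari}(B,A)$. For normalized $C$, $\mathrm{ganit}_C(A)_0=A_0$ and for $r\ge1$ $$\mathrm{ganit}_C(A)_r=\sum_{s\ge1}\ \sum_{0=q_0<q_1<\dots<q_s=r}A_s(X_{q_0+1},\dots,X_{q_{s-1}+1}\mid Y_{q_0+1:q_1},\dots,Y_{q_{s-1}+1:q_s})\prod_{i=1}^sC_{q_i-q_{i-1}-1}(X_{q_{i-1}+2}-X_{q_{i-1}+1},\dots,X_{q_i}-X_{q_{i-1}+1}\mid Y_{q_{i-1}+2},\dots,Y_{q_i}).$$ Let $\mathrm{pic},\mathrm{poc}$ be the normalized bimoulds with $\mathrm{pic}_r=\frac1{X_1\cdots X_r}$, $\mathrm{poc}_r=-\frac1{X_1(X_1-X_2)\cdots(X_{r-1}-X_r)}$ for $r\ge1$. The operators $\mathrm{ganit}_{\mathrm{pic}}$ and $\mathrm{ganit}_{\mathrm{poc}}$ are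 mutually inverse, and $\mathrm{uri}(A,B)=\mathrm{ganit}_{\mathrm{pic}}\bigl(\mathrm{ari}(\mathrm{ganit}_{\mathrm{poc}}A,\mathrm{ganit}_{\mathrm{poc}}B)\bigr)$. **The product preuri.** Let $\mathcal D_r(F\mid z_0,\dots,z_r)=\sum_{s=0}^r\frac{F(z_s)}{\prod_{k\ne s}(z_k-z_s)}$. For $B\in\mathrm{BARI}^{\mathrm{pol}}$ define the bimould $C(B)$ by $C(B)_0=C(B)_1=0$ and, for $m\ge2$, $C(B)_m=\sum_{r=1}^{m-1}\bigl(L_{m,r}(B)-R_{m,r}(B)\bigr)$, where $$L_{m,r}(B)=\mathcal D_r\bigl(t\mapsto B_{m-r}(X_r-t,\dots,X_{m-1}-t\mid Y_r,\dots,Y_{m-1})\ \big|\ 0,X_1,\dots,X_{r-1},X_m\bigr),$$ $$R_{m,r}(B)=\mathcal D_r\bigl(t\mapsto B_{m-r}(X_{r+1}-t,\dots,X_m-t\mid Y_{r+1},\dots,Y_m)\ \big|\ 0,X_1,\dots,X_r\bigr).$$ Put $\mathrm{urit}(B)=\mathrm{arit}(B)+\mathrm{anit}(C(B))$ and $\mathrm{preuri}(A,B)=\mathrm{urit}(B)(A)+\mathrm{mu}(A,B)$. *)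

theory Defs
  imports Complex_Main "HOL-Library.Poly_Mapping" "HOL-Computational_Algebra.Fraction_Field"
begin

section \<open>Rational functions in the indeterminates X_1, Y_1, X_2, Y_2, ...\<close>

datatype var = VX nat | VY nat

text \<open>The order on variables carries no mathematical meaning: it is only there because the
  integral domain instance of \<^type>\<open>poly_mapping\<close> asks for one.\<close>

fun var_code :: "var \<Rightarrow> nat" where
  "var_code (VX i) = 2 * i"
| "var_code (VY i) = 2 * i + 1"

lemma var_code_inj: "var_code u = var_code v \<Longrightarrow> u = v"
  by (cases u; cases v; simp; presburger)

instantiation var :: linorder
begin

definition less_eq_var :: "var \<Rightarrow> var \<Rightarrow> bool" where
  "u \<le> v \<longleftrightarrow> var_code u \<le> var_code v"

definition less_var :: "var \<Rightarrow> var \<Rightarrow> bool" where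
  "u < v \<longleftrightarrow> var_code u < var_code v"

instance
  by standard (auto simp: less_eq_var_def less_var_def intro: var_code_inj)

end

type_synonym monomial = "var \<Rightarrow>\<^sub>0 nat"
type_synonym mpoly = "monomial \<Rightarrow>\<^sub>0 rat"

text \<open>The components of all bimoulds below live in the field \<open>\<rat>(X\<^sub>1, Y\<^sub>1, X\<^sub>2, Y\<^sub>2, \<dots>)\<close>.
  Starting from polynomial bimoulds, the operations below only produce elements of
  \<open>\<rat>[X\<^sub>1, Y\<^sub>1, \<dots>, X\<^sub>r, Y\<^sub>r][1/X\<^sub>i, 1/(X\<^sub>i - X\<^sub>j)]\<close> in depth \<open>r\<close>, which is a subring both of this field
  and of the localised power series ring \<open>\<L>\<^sub>r\<close>.\<close>

type_synonym ratfun = "mpoly fract"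

definition rf_of_poly :: "mpoly \<Rightarrow> ratfun" where
  "rf_of_poly p = Fract p 1"

definition rf_const :: "rat \<Rightarrow> ratfun" where
  "rf_const c = rf_of_poly (Poly_Mapping.single 0 c)"

definition rf_var :: "var \<Rightarrow> ratfun" where
  "rf_var v = rf_of_poly (Poly_Mapping.single (Poly_Mapping.single v 1) 1)"

abbreviation Xv :: "nat \<Rightarrow> ratfun" where "Xv i \<equiv> rf_var (VX i)"
abbreviation Yv :: "nat \<Rightarrow> ratfun" where "Yv i \<equiv> rf_var (VY i)"

definition vars :: "mpoly \<Rightarrow> var set" where
  "vars p = (\<Union>m\<in>Poly_Mapping.keys p. Poly_Mapping.keys m)"

definition psubst :: "(var \<Rightarrow> ratfun) \<Rightarrow> mpoly \<Rightarrow> ratfun" where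
  "psubst \<sigma> p = (\<Sum>m\<in>Poly_Mapping.keys p. rf_const (Poly_Mapping.lookup p m) *
     (\<Prod>v\<in>Poly_Mapping.keys m. \<sigma> v ^ Poly_Mapping.lookup m v))"

text \<open>Substitution \<open>\<sigma>\<close> into a rational function that admits a representation as a fraction whose
  denominator does not vanish under \<open>\<sigma>\<close>; the value does not depend on that representation,
  see \<open>rsubst_Fract\<close> below. This is the case for every substitution used in this theory: it is
  either into a polynomial, or by linear forms that are linearly independent.\<close>

definition rsubst :: "(var \<Rightarrow> ratfun) \<Rightarrow> ratfun \<Rightarrow> ratfun" where
  "rsubst \<sigma> f = (THE v. \<exists>p q. psubst \<sigma> q \<noteq> 0 \<and> f = Fract p q \<and> v = psubst \<sigma> p / psubst \<sigma> q)"

lemma rf_const_simps: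
  "rf_const 0 = 0" "rf_const (a + b) = rf_const a + rf_const b"
  "rf_const (a * b) = rf_const a * rf_const b"
  by (simp_all add: rf_const_def rf_of_poly_def fract_collapse single_add mult_single)

lemma psubst_superset:
  assumes "finite S" "Poly_Mapping.keys p \<subseteq> S"
  shows "psubst \<sigma> p = (\<Sum>m\<in>S. rf_const (Poly_Mapping.lookup p m) *
     (\<Prod>v\<in>Poly_Mapping.keys m. \<sigma> v ^ Poly_Mapping.lookup m v))"
  unfolding psubst_def using assms
  by (intro sum.mono_neutral_left) (auto simp: in_keys_iff rf_const_simps)

lemma psubst_zero [simp]: "psubst \<sigma> 0 = 0"
  by (simp add: psubst_def)

lemma psubst_add: "psubst \<sigma> (p + q) = psubst \<sigma> p + psubst \<sigma> q"
proof -
  let ?S = "Poly_Mapping.keys p \<union> Poly_Mapping.keys q"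
  have "Poly_Mapping.keys (p + q) \<subseteq> ?S" by (rule keys_add)
  then show ?thesis
    by (simp add: psubst_superset[of ?S] lookup_add rf_const_simps algebra_simps sum.distrib)
qed

lemma monomial_subst_add:
  fixes \<sigma> :: "var \<Rightarrow> ratfun"
  shows "(\<Prod>v\<in>Poly_Mapping.keys (m + n). \<sigma> v ^ Poly_Mapping.lookup (m + n) v) =
    (\<Prod>v\<in>Poly_Mapping.keys m. \<sigma> v ^ Poly_Mapping.lookup m v) *
    (\<Prod>v\<in>Poly_Mapping.keys n. \<sigma> v ^ Poly_Mapping.lookup n v)"
proof -
  let ?S = "Poly_Mapping.keys m \<union> Poly_Mapping.keys n"
  have *: "(\<Prod>v\<in>Poly_Mapping.keys k. \<sigma> v ^ Poly_Mapping.lookup k v) =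
      (\<Prod>v\<in>?S. \<sigma> v ^ Poly_Mapping.lookup k v)" if "Poly_Mapping.keys k \<subseteq> ?S" for k
    using that by (intro prod.mono_neutral_left) (auto simp: in_keys_iff)
  show ?thesis
    by (subst (1 2 3) *) (auto simp: keys_add lookup_add power_add prod.distrib
        dest: subsetD[OF keys_add])
qed

lemma psubst_single:
  "psubst \<sigma> (Poly_Mapping.single m c) =
    rf_const c * (\<Prod>v\<in>Poly_Mapping.keys m. \<sigma> v ^ Poly_Mapping.lookup m v)"
  by (simp add: psubst_def rf_const_simps)

lemma mpoly_induct:
  assumes "\<And>m c. P (Poly_Mapping.single m c)" "\<And>p q. P p \<Longrightarrow> P q \<Longrightarrow> P (p + q)"
  shows "P (p :: mpoly)"
proof -
  have "P (\<Sum>m\<in>S. Poly_Mapping.single m (Poly_Mapping.lookup p m))" if "finite S" for S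
    using that
    by (induction S) (use assms(1)[of 0 0] in \<open>auto intro: assms\<close>)
  moreover have "(\<Sum>m\<in>Poly_Mapping.keys p. Poly_Mapping.single m (Poly_Mapping.lookup p m)) = p"
    by (rule poly_mapping_eqI)
      (auto simp: lookup_sum lookup_single when_def in_keys_iff sum.delta)
  ultimately show ?thesis
    by (metis finite_keys)
qed

lemma psubst_mult: "psubst \<sigma> (p * q) = psubst \<sigma> p * psubst \<sigma> q"
proof (induction p rule: mpoly_induct)
  case (1 m c)
  show ?case
    by (induction q rule: mpoly_induct)
      (simp_all add: mult_single psubst_single monomial_subst_add rf_const_simps
        psubst_add distrib_left)
qed (simp add: psubst_add distrib_right)

lemma rsubst_Fract:
  assumes "psubst \<sigma> q \<noteq> 0"
  shows "rsubst \<sigma> (Fract p q) = psubst \<sigma> p / psubst \<sigma> q"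
  unfolding rsubst_def
proof (rule the_equality)
  fix v
  assume "\<exists>p' q'. psubst \<sigma> q' \<noteq> 0 \<and> Fract p q = Fract p' q' \<and> v = psubst \<sigma> p' / psubst \<sigma> q'"
  then obtain p' q' where *: "psubst \<sigma> q' \<noteq> 0" "Fract p q = Fract p' q'"
    "v = psubst \<sigma> p' / psubst \<sigma> q'" by blast
  then have "q \<noteq> 0" "q' \<noteq> 0" using assms by auto
  with * have "p * q' = p' * q" by (simp add: eq_fract)
  then have "psubst \<sigma> p * psubst \<sigma> q' = psubst \<sigma> p' * psubst \<sigma> q"
    by (metis psubst_mult)
  then show "v = psubst \<sigma> p / psubst \<sigma> q"
    using * assms by (simp add: frac_eq_eq)
qed (use assms in blast)

section \<open>Bimoulds\<close>

type_synonym bimould = "nat \<Rightarrow> ratfun"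

definition list_subst :: "ratfun list \<Rightarrow> ratfun list \<Rightarrow> var \<Rightarrow> ratfun" where
  "list_subst xs ys v = (case v of
     VX i \<Rightarrow> if 1 \<le> i \<and> i \<le> length xs then xs ! (i - 1) else 0
   | VY i \<Rightarrow> if 1 \<le> i \<and> i \<le> length ys then ys ! (i - 1) else 0)"

text \<open>\<open>A\<^sub>r(x\<^sub>1, \<dots>, x\<^sub>r | y\<^sub>1, \<dots>, y\<^sub>r)\<close> for \<open>xs = [x\<^sub>1, \<dots>, x\<^sub>r]\<close> and \<open>ys = [y\<^sub>1, \<dots>, y\<^sub>r]\<close>.
  The default value \<open>0\<close> in \<^const>\<open>list_subst\<close> is immaterial, as a component of depth \<open>r\<close> only
  involves \<open>X\<^sub>1, \<dots>, X\<^sub>r, Y\<^sub>1, \<dots>, Y\<^sub>r\<close>.\<close>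

definition ev :: "bimould \<Rightarrow> nat \<Rightarrow> ratfun list \<Rightarrow> ratfun list \<Rightarrow> ratfun" where
  "ev A r xs ys = rsubst (list_subst xs ys) (A r)"

definition Xs :: "nat \<Rightarrow> nat \<Rightarrow> ratfun list" where
  "Xs a b = map Xv [a..<Suc b]"

definition Ys :: "nat \<Rightarrow> nat \<Rightarrow> ratfun list" where
  "Ys a b = map Yv [a..<Suc b]"

definition Ysum :: "nat \<Rightarrow> nat \<Rightarrow> ratfun" where
  "Ysum a b = (\<Sum>j=a..b. Yv j)"

text \<open>\<open>Xsd a b t = [X\<^sub>a - t, \<dots>, X\<^sub>b - t]\<close>\<close>

definition Xsd :: "nat \<Rightarrow> nat \<Rightarrow> ratfun \<Rightarrow> ratfun list" where
  "Xsd a b t = map (\<lambda>x. x - t) (Xs a b)"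

definition BARI_pol :: "bimould set" where
  "BARI_pol = {A. A 0 = 0 \<and> finite {r. A r \<noteq> 0} \<and>
     (\<forall>r. \<exists>p. vars p \<subseteq> VX ` {1..r} \<union> VY ` {1..r} \<and> A r = rf_of_poly p)}"

section \<open>Flexion operations\<close>

definition mu :: "bimould \<Rightarrow> bimould \<Rightarrow> bimould" where
  "mu A B r = (\<Sum>i=0..r. ev A i (Xs 1 i) (Ys 1 i) * ev B (r - i) (Xs (i + 1) r) (Ys (i + 1) r))"

definition amit :: "bimould \<Rightarrow> bimould \<Rightarrow> bimould" where
  "amit B A r = (\<Sum>(a, b) \<in> {(a, b). 1 \<le> a \<and> a < b \<and> b \<le> r}.
     ev A (r - b + a) (Xs 1 (a - 1) @ Xs b r) (Ys 1 (a - 1) @ [Ysum a b] @ Ys (b + 1) r) *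
     ev B (b - a) (Xsd a (b - 1) (Xv b)) (Ys a (b - 1)))"

definition anit :: "bimould \<Rightarrow> bimould \<Rightarrow> bimould" where
  "anit B A r = (\<Sum>(a, b) \<in> {(a, b). 1 \<le> a \<and> a < b \<and> b \<le> r}.
     ev A (r - b + a) (Xs 1 a @ Xs (b + 1) r) (Ys 1 (a - 1) @ [Ysum a b] @ Ys (b + 1) r) *
     ev B (b - a) (Xsd (a + 1) b (Xv a)) (Ys (a + 1) b))"

definition arit :: "bimould \<Rightarrow> bimould \<Rightarrow> bimould" where
  "arit B A r = amit B A r - anit B A r"

definition preari :: "bimould \<Rightarrow> bimould \<Rightarrow> bimould" where
  "preari A B r = arit B A r + mu A B r"

definition ari :: "bimould \<Rightarrow> bimould \<Rightarrow> bimould" where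
  "ari A B r = preari A B r - preari B A r"

text \<open>The sequences \<open>0 = q\<^sub>0 < q\<^sub>1 < \<dots> < q\<^sub>s = r\<close>, as lists of length \<open>s + 1\<close>; there are none for \<open>s > r\<close>.\<close>

definition cuts :: "nat \<Rightarrow> nat \<Rightarrow> nat list set" where
  "cuts s r = {q. length q = s + 1 \<and> q ! 0 = 0 \<and> q ! s = r \<and> sorted_wrt (<) q}"

definition ganit :: "bimould \<Rightarrow> bimould \<Rightarrow> bimould" where
  "ganit C A r = (if r = 0 then A 0 else
     (\<Sum>s=1..r. \<Sum>q\<in>cuts s r.
        ev A s (map (\<lambda>i. Xv (q ! (i - 1) + 1)) [1..<Suc s])
               (map (\<lambda>i. Ysum (q ! (i - 1) + 1) (q ! i)) [1..<Suc s]) *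
        (\<Prod>i=1..s. ev C (q ! i - q ! (i - 1) - 1)
           (Xsd (q ! (i - 1) + 2) (q ! i) (Xv (q ! (i - 1) + 1)))
           (Ys (q ! (i - 1) + 2) (q ! i)))))"

definition pic :: bimould where
  "pic r = 1 / (\<Prod>i=1..r. Xv i)"

definition poc :: bimould where
  "poc r = (if r = 0 then 1 else - 1 / (Xv 1 * (\<Prod>i=1..<r. Xv i - Xv (i + 1))))"

definition uri :: "bimould \<Rightarrow> bimould \<Rightarrow> bimould" where
  "uri A B = ganit pic (ari (ganit poc A) (ganit poc B))"

section \<open>The product preuri\<close>

text \<open>\<open>divD F [z\<^sub>0, \<dots>, z\<^sub>r]\<close> is \<open>\<D>\<^sub>r(F | z\<^sub>0, \<dots>, z\<^sub>r)\<close>.\<close>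

definition divD :: "(ratfun \<Rightarrow> ratfun) \<Rightarrow> ratfun list \<Rightarrow> ratfun" where
  "divD F zs = (\<Sum>s<length zs. F (zs ! s) / (\<Prod>k\<in>{..<length zs} - {s}. zs ! k - zs ! s))"

definition Lterm :: "bimould \<Rightarrow> nat \<Rightarrow> nat \<Rightarrow> ratfun" where
  "Lterm B m r = divD (\<lambda>t. ev B (m - r) (Xsd r (m - 1) t) (Ys r (m - 1)))
     (0 # Xs 1 (r - 1) @ [Xv m])"

definition Rterm :: "bimould \<Rightarrow> nat \<Rightarrow> nat \<Rightarrow> ratfun" where
  "Rterm B m r = divD (\<lambda>t. ev B (m - r) (Xsd (r + 1) m t) (Ys (r + 1) m)) (0 # Xs 1 r)"

definition Cmould :: "bimould \<Rightarrow> bimould" where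
  "Cmould B m = (if m < 2 then 0 else (\<Sum>r=1..m - 1. Lterm B m r - Rterm B m r))"

definition urit :: "bimould \<Rightarrow> bimould \<Rightarrow> bimould" where
  "urit B A r = arit B A r + anit (Cmould B) A r"

definition preuri :: "bimould \<Rightarrow> bimould \<Rightarrow> bimould" where
  "preuri A B r = urit B A r + mu A B r"

end

theory Submission
  imports Defs
begin

text \<open>Why the theorem holds. The components of the bimoulds are regarded as functions on words
  whose letters are pairs \<open>(x, y)\<close> of field elements. On such functions, \<open>ganit\<^bsub>C\<^esub>\<close> is an
  automorphism for the concatenation product \<open>mu\<close> (it contracts the blocks of all factorisations
  of a word), and \<open>amit(B)\<close>, \<open>anit(B)\<close> are derivations (they contract one factor). So the claim is
  that conjugating the derivation \<open>arit(ganit\<^bsub>poc\<^esub> B)\<close> by \<open>ganit\<^bsub>pic\<^esub>\<close> gives the derivation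
  \<open>urit(B)\<close>. It is an identity of operators which holds for arbitrary functions \<open>A\<close> and \<open>B\<close>
  with \<open>B\<close> zero at the empty word, as long as the \<open>X\<close>-entries of the words are distinct.

  An automorphism and two derivations are compatible as soon as they are so on functions of one
  letter (\<open>block_aut_der_commute\<close>). For a function \<open>f\<close> of one letter, write out both sides at a
  word with \<open>X\<close>-entries \<open>u\<^sub>0, \<dots>, u\<^sub>m\<close>, putting \<open>B\<close> for \<open>ganit\<^bsub>pic\<^esub>\<close> of the original one. The
  function \<open>f\<close> is evaluated at letters \<open>(u\<^sub>b, y\<^sub>0 + \<dots> + y\<^sub>m)\<close>. For \<open>b > 0\<close> the coefficients agree
  by multiplicativity of \<open>ganit\<^bsub>pic\<^esub>\<close> (\<open>ganit_word_amit_ker\<close>). For \<open>b = 0\<close> the identity to be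
  proved is linear in the values \<open>B(u\<^sub>p - t, \<dots>, u\<^sub>q - t)\<close>; the values of \<open>arit(B)\<close> are divided
  differences with one node, and together with the divided differences in \<open>C(B)\<close> the terms
  belonging to a fixed window \<open>[p, q]\<close> telescope (\<open>window_identity\<close>). This is what the formula for
  \<open>C(B)\<close> is made for.

  That \<open>ganit\<^bsub>pic\<^esub>\<close> and \<open>ganit\<^bsub>poc\<^esub>\<close> are inverse to each other is again a statement about the
  weights of single blocks (\<open>ganit_word_pic_poc\<close>).

  The remaining part passes between rational functions and functions on words. A component is only
  known as a rational function in \<open>X\<^sub>1, Y\<^sub>1, \<dots>\<close>, and the value of a composite operation at a
  flexed word has to be computed by substitution. Substitutions are treated as relations between
  field elements that are compatible with the field operations (\<open>specializes\<close>), all operators on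
  words are compatible with them (\<open>natural\<close>), and hence an operation on bimoulds is described by
  the corresponding operator on words as soon as this is true at the word of variables
  (\<open>regularI\<close>).\<close>

section \<open>Sums over factorisations, automorphisms and derivations\<close>

text \<open>The sum of \<open>K u v\<close> over all factorisations \<open>w = u @ v\<close>, both factors possibly empty. For
  \<open>K u v = A u * B v\<close> this is \<open>mu A B\<close>; kernels that are not products let the lemmas below speak
  about tensors without a tensor product.\<close>

definition deconc :: "('l list \<Rightarrow> 'l list \<Rightarrow> 'k) \<Rightarrow> 'l list \<Rightarrow> 'k::comm_ring_1" where
  "deconc K w = (\<Sum>i\<le>length w. K (take i w) (drop i w))"

lemma deconc_Nil [simp]: "deconc K [] = K [] []"
  by (simp add: deconc_def)

lemma deconc_Cons: "deconc K (a # w) = K [] (a # w) + deconc (\<lambda>u v. K (a # u) v) w"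
  by (simp add: deconc_def sum.atMost_Suc_shift del: sum.atMost_Suc)

lemma deconc_cong:
  assumes "\<And>u v. u @ v = w \<Longrightarrow> K u v = K' u v"
  shows "deconc K w = deconc K' w"
  using assms by (simp add: deconc_def)

lemma deconc_zero [simp]: "deconc (\<lambda>u v. 0) w = 0"
  by (simp add: deconc_def)

lemma deconc_add: "deconc (\<lambda>u v. K u v + K' u v) w = deconc K w + deconc K' w"
  by (simp add: deconc_def sum.distrib)

lemma deconc_diff: "deconc (\<lambda>u v. K u v - K' u v) w = deconc K w - deconc K' w"
  by (simp add: deconc_def sum_subtractf)

lemma deconc_mult_left: "deconc (\<lambda>u v. c * K u v) w = c * deconc K w"
  by (simp add: deconc_def sum_distrib_left)

lemma deconc_mult_right: "deconc (\<lambda>u v. K u v * c) w = deconc K w * c"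
  by (simp add: deconc_def sum_distrib_right)

text \<open>Both sides sum over the factorisations of \<open>w\<close> into three factors.\<close>

lemma deconc_assoc:
  "deconc (\<lambda>x v. deconc (\<lambda>u p. K u p v) x) w = deconc (\<lambda>u y. deconc (\<lambda>p v. K u p v) y) w"
proof (induction w arbitrary: K)
  case (Cons a w)
  show ?case
    using Cons.IH[of "\<lambda>u. K (a # u)"] by (simp add: deconc_Cons deconc_add add.assoc)
qed simp

text \<open>A cut inside a nonempty word selects a letter in two ways: the last one of the left factor
  or the first one of the right factor. Here the selected letter is moved from one side to the
  other.\<close>

lemma deconc_last_first:
  "deconc (\<lambda>u v. if v = [] then 0 else F u (hd v) (tl v)) (a # w) =
    deconc (\<lambda>u v. F (butlast (a # u)) (last (a # u)) v) w"
proof (induction w arbitrary: a F)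
  case (Cons b w)
  have "deconc (\<lambda>u v. if v = [] then 0 else F u (hd v) (tl v)) (a # b # w) =
      F [] a (b # w) + deconc (\<lambda>u v. if v = [] then 0 else F (a # u) (hd v) (tl v)) (b # w)"
    by (subst deconc_Cons) simp
  also have "\<dots> = F [] a (b # w) + deconc (\<lambda>u v. F (a # butlast (b # u)) (last (b # u)) v) w"
    using Cons.IH[of "\<lambda>u. F (a # u)" b] by simp
  finally show ?case
    by (simp add: deconc_Cons)
qed (simp add: deconc_Cons)

text \<open>The \<open>mu\<close>-automorphism that sums over all factorisations of a word into nonempty blocks \<open>u\<close>,
  contracts each block to the single letter \<open>h u\<close>, and weights it by \<open>c u\<close>. The operators \<open>ganit\<close>
  are of this form. The recursion splits off the first block and absorbs its contracted letter
  into the function; this currying lets the structural inductions below run over functions \<open>A\<close>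
  that have no product structure.\<close>

function block_aut :: "('l list \<Rightarrow> 'k) \<Rightarrow> ('l list \<Rightarrow> 'l) \<Rightarrow> ('l list \<Rightarrow> 'k) \<Rightarrow> 'l list \<Rightarrow> 'k::comm_ring_1"
  where
    "block_aut c h A [] = A []"
  | "block_aut c h A (a # w) = (\<Sum>i\<le>length w.
       c (a # take i w) * block_aut c h (\<lambda>v. A (h (a # take i w) # v)) (drop i w))"
  by pat_completeness auto
termination
  by (relation "measure (\<lambda>(c, h, A, w). length w)") auto

declare block_aut.simps(2) [simp del]

lemma block_aut_Cons:
  "block_aut c h A (a # w) = deconc (\<lambda>u v. c (a # u) * block_aut c h (\<lambda>x. A (h (a # u) # x)) v) w"
  by (simp add: deconc_def block_aut.simps(2))

lemma block_aut_induct [case_names Nil Cons]: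
  assumes "\<And>A. P A []"
    and "\<And>A a w. (\<And>B u v. u @ v = w \<Longrightarrow> P B v) \<Longrightarrow> P A (a # w)"
  shows "P (A :: 'x) (w :: 'l list)"
proof (induction w arbitrary: A rule: length_induct)
  case (1 w)
  show ?case
  proof (cases w)
    case (Cons a w')
    show ?thesis
      unfolding Cons using 1 by (intro assms(2)) (auto simp: Cons)
  qed (use assms(1) in simp)
qed

text \<open>The only values of \<open>A\<close> that matter are those at the words obtained from \<open>w\<close> by contraction.
  This is how genericity and the total of the \<open>Y\<close>-entries, which contraction preserves, enter.\<close>

lemma block_aut_cong:
  assumes "\<And>bs. concat bs = w \<Longrightarrow> [] \<notin> set bs \<Longrightarrow> A (map h bs) = A' (map h bs)"
  shows "block_aut c h A w = block_aut c h A' w"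
  using assms
proof (induction A w arbitrary: A' rule: block_aut_induct)
  case (Nil A)
  show ?case using Nil[of "[]"] by simp
next
  case (Cons A a w)
  show ?case
    unfolding block_aut_Cons
  proof (intro deconc_cong arg_cong2[of _ _ _ _ "(*)"] refl Cons.IH)
    fix u v bs
    assume "u @ v = w" "concat bs = v" "[] \<notin> set bs"
    then show "A (h (a # u) # map h bs) = A' (h (a # u) # map h bs)"
      using Cons.prems[of "(a # u) # bs"] by simp
  qed auto
qed

text \<open>Linear functionals on functions of a letter. They occur as the depth one part of a
  derivation, and additivity with homogeneity is all that is needed to exchange them with the
  finite sums of \<^const>\<open>deconc\<close> and \<^const>\<open>block_aut\<close>.\<close>

definition linear_fun :: "(('i \<Rightarrow> 'k) \<Rightarrow> 'k::comm_ring_1) \<Rightarrow> bool" where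
  "linear_fun T \<longleftrightarrow> (\<forall>f g. T (\<lambda>i. f i + g i) = T f + T g) \<and> (\<forall>c f. T (\<lambda>i. c * f i) = c * T f)"

lemma linear_fun_sum:
  assumes "linear_fun T"
  shows "T (\<lambda>i. \<Sum>j\<in>J. g j i) = (\<Sum>j\<in>J. T (g j))"
proof -
  have *: "T (\<lambda>i. f i + g i) = T f + T g" "T (\<lambda>i. c * f i) = c * T f" for c f g
    using assms by (auto simp: linear_fun_def)
  have "T (\<lambda>i. 0) = 0"
    using *(2)[of 0 "\<lambda>i. 0"] by simp
  then show ?thesis
    by (induction J rule: infinite_finite_induct) (simp_all add: *)
qed

lemma linear_fun_deconc: "linear_fun T \<Longrightarrow> T (\<lambda>i. deconc (K i) w) = deconc (\<lambda>u v. T (\<lambda>i. K i u v)) w"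
  unfolding deconc_def by (rule linear_fun_sum)

lemma linear_fun_mult_left: "linear_fun T \<Longrightarrow> T (\<lambda>i. k * f i) = k * T f"
  by (simp add: linear_fun_def)

lemma linear_fun_block_aut:
  assumes "linear_fun T"
  shows "T (\<lambda>i. block_aut c h (A i) w) = block_aut c h (\<lambda>v. T (\<lambda>i. A i v)) w"
proof (induction A w rule: block_aut_induct)
  case (Cons A a w)
  have "T (\<lambda>i. block_aut c h (A i) (a # w)) =
      deconc (\<lambda>u v. c (a # u) * T (\<lambda>i. block_aut c h (\<lambda>x. A i (h (a # u) # x)) v)) w"
    by (simp add: block_aut_Cons linear_fun_deconc[OF assms] linear_fun_mult_left[OF assms])
  also have "\<dots> = deconc (\<lambda>u v. c (a # u) * block_aut c h (\<lambda>x. T (\<lambda>i. A i (h (a # u) # x))) v) w"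
    by (intro deconc_cong arg_cong2[of _ _ _ _ "(*)"] refl Cons.IH)
  finally show ?case
    by (simp add: block_aut_Cons)
qed simp

lemma block_aut_add: "block_aut c h (\<lambda>v. A v + B v) w = block_aut c h A w + block_aut c h B w"
  using linear_fun_block_aut[of "\<lambda>f. f True + f False" c h "\<lambda>b. if b then A else B" w]
  by (simp add: linear_fun_def algebra_simps)

lemma block_aut_mult_left: "block_aut c h (\<lambda>v. k * A v) w = k * block_aut c h A w"
  using linear_fun_block_aut[of "\<lambda>f. k * f ()" c h "\<lambda>_. A" w] by
      (simp add: linear_fun_def algebra_simps)

lemma block_aut_mult_right: "block_aut c h (\<lambda>v. A v * k) w = block_aut c h A w * k"
  using block_aut_mult_left[of c h k A w] by (simp add: mult.commute)

lemma block_aut_diff: "block_aut c h (\<lambda>v. A v - B v) w = block_aut c h A w - block_aut c h B w"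
  using block_aut_add[of c h A "\<lambda>v. (-1) * B v" w] by (simp only: block_aut_mult_left) simp

lemma block_aut_zero [simp]: "block_aut c h (\<lambda>v. 0) w = 0"
  using block_aut_mult_left[of c h 0 "\<lambda>v. 0"] by simp

text \<open>Multiplicativity: a block lies in the left or in the right factor of a cut between blocks.
  The statement for arbitrary kernels, not only for products \<open>A u * B v\<close>, is what the inductions
  on curried functions require.\<close>

lemma block_aut_deconc:
  "block_aut c h (deconc K) w = deconc (\<lambda>p q. block_aut c h (\<lambda>u. block_aut c h (K u) q) p) w"
proof (induction K w rule: block_aut_induct)
  case (Cons K a w)
  have "block_aut c h (deconc K) (a # w) =
      block_aut c h (K []) (a # w) +
      deconc (\<lambda>u y. c (a # u) * block_aut c h (deconc (\<lambda>s. K (h (a # u) # s))) y) w"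
    by (simp add: block_aut_Cons deconc_Cons block_aut_add distrib_left deconc_add)
  also have "deconc (\<lambda>u y. c (a # u) * block_aut c h (deconc (\<lambda>s. K (h (a # u) # s))) y) w =
      deconc (\<lambda>u y. c (a # u) * deconc
          (\<lambda>p q. block_aut c h (\<lambda>s. block_aut c h (K (h (a # u) # s)) q) p) y) w"
    by (intro deconc_cong arg_cong2[of _ _ _ _ "(*)"] refl Cons.IH)
  also have "\<dots> = deconc (\<lambda>x q. deconc (\<lambda>u p. c (a # u) *
      block_aut c h (\<lambda>s. block_aut c h (K (h (a # u) # s)) q) p) x) w"
    by (simp add: deconc_assoc deconc_mult_left)
  finally show ?case
    by (simp add: block_aut_Cons deconc_Cons)
qed simp

text \<open>A function supported on words of length one only sees the factorisation into one block.\<close>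

lemma block_aut_letter:
  fixes g :: "'l \<Rightarrow> 'k::comm_ring_1"
  shows "block_aut c h (\<lambda>u. if length u = 1 then g (hd u) else 0) w =
    (if w = [] then 0 else c w * g (h w))"
proof (cases w)
  case (Cons a w')
  have empty: "block_aut c h (\<lambda>x. if x = [] then k else 0) v = (if v = [] then k else 0)" for k v
    by (cases v) (simp_all add: block_aut_Cons)
  have "deconc (\<lambda>u v. if v = [] then F u else 0) w' = F w'" for F :: "'l list \<Rightarrow> 'k"
    by (induction w' arbitrary: F) (simp_all add: deconc_Cons)
  then show ?thesis
    by (simp add: Cons block_aut_Cons empty if_distrib[of "\<lambda>x. _ * x"] cong: if_cong)
qed simp

text \<open>A factorisation into blocks of blocks is a factorisation together with factorisations of its
  blocks, so automorphisms that contract in compatible ways compose, and the new weight of a block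
  is the inner weight transformed by the outer automorphism.\<close>

lemma block_aut_comp:
  assumes h: "\<And>bs. [] \<notin> set bs \<Longrightarrow> bs \<noteq> [] \<Longrightarrow> h (map h bs) = h (concat bs)"
  shows "block_aut c h (block_aut d h A) w = block_aut (block_aut c h d) h A w"
proof (induction A w rule: block_aut_induct)
  case (Cons A a w)
  let ?e = "block_aut c h d"
  have inner: "block_aut c h (\<lambda>x. block_aut d h A (h (a # u) # x)) y =
      deconc (\<lambda>p q. block_aut c h (\<lambda>s. d (h (a # u) # s)) p *
          block_aut ?e h (\<lambda>z. A (h (a # u @ p) # z)) q) y"
    if "u @ y = w" for u y
  proof -
    let ?l = "h (a # u)"
    have "block_aut c h (\<lambda>x. block_aut d h A (?l # x)) y =
        deconc (\<lambda>p q. block_aut c h (\<lambda>s. d (?l # s) *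
            block_aut c h (block_aut d h (\<lambda>z. A (h (?l # s) # z))) q) p) y"
      by (simp add: block_aut_Cons block_aut_deconc block_aut_mult_left)
    also have "\<dots> = deconc (\<lambda>p q. block_aut c h (\<lambda>s. d (?l # s) *
        block_aut ?e h (\<lambda>z. A (h (a # u @ p) # z)) q) p) y"
    proof (intro deconc_cong block_aut_cong arg_cong2[of _ _ _ _ "(*)"] refl)
      fix p q bs
      assume *: "p @ q = y" "concat bs = p" "[] \<notin> set bs"
      then have "h (?l # map h bs) = h (a # u @ p)"
        using h[of "(a # u) # bs"] by simp
      then show "block_aut c h (block_aut d h (\<lambda>z. A (h (?l # map h bs) # z))) q =
          block_aut ?e h (\<lambda>z. A (h (a # u @ p) # z)) q"
        using Cons.IH[of "u @ p" q] * that by simp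
    qed
    also have "\<dots> = deconc (\<lambda>p q. block_aut c h (\<lambda>s. d (?l # s)) p *
        block_aut ?e h (\<lambda>z. A (h (a # u @ p) # z)) q) y"
      by (simp add: mult.commute[of "d _"] mult.commute[of _ "block_aut ?e _ _ _"]
          block_aut_mult_left)
    finally show ?thesis .
  qed
  have "block_aut c h (block_aut d h A) (a # w) =
      deconc (\<lambda>u y. c (a # u) * block_aut c h (\<lambda>x. block_aut d h A (h (a # u) # x)) y) w"
    by (simp add: block_aut_Cons)
  also have "\<dots> = deconc (\<lambda>u y. c (a # u) * deconc (\<lambda>p q. block_aut c h (\<lambda>s. d (h (a # u) # s)) p *
      block_aut ?e h (\<lambda>z. A (h (a # u @ p) # z)) q) y) w"
    by (intro deconc_cong arg_cong2[of _ _ _ _ "(*)"] refl inner)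
  also have "\<dots> = deconc (\<lambda>u y. deconc (\<lambda>p q. c (a # u) * (block_aut c h (\<lambda>s. d (h (a # u) # s)) p *
      block_aut ?e h (\<lambda>z. A (h (a # u @ p) # z)) q)) y) w"
    by (simp add: deconc_mult_left)
  also have "\<dots> = deconc (\<lambda>x q. deconc (\<lambda>u p. c (a # u) * (block_aut c h (\<lambda>s. d (h (a # u) # s)) p *
      block_aut ?e h (\<lambda>z. A (h (a # u @ p) # z)) q)) x) w"
    by (rule deconc_assoc[symmetric])
  also have "\<dots> = deconc (\<lambda>x q. deconc (\<lambda>u p. c (a # u) * block_aut c h (\<lambda>s. d (h (a # u) # s)) p *
      block_aut ?e h (\<lambda>z. A (h (a # x) # z)) q) x) w"
    by (intro deconc_cong) (auto simp: mult.assoc)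
  also have "\<dots> = block_aut ?e h A (a # w)"
    by (simp add: block_aut_Cons deconc_mult_right)
  finally show ?case .
qed simp

text \<open>The \<open>mu\<close>-derivation whose depth one part is \<open>d\<close>: the sum over all \<open>w = u @ p @ v\<close> with
  \<open>p \<noteq> []\<close>, in which \<open>d p\<close> replaces the factor \<open>p\<close> by a linear combination of letters. Both \<open>amit\<close>
  and \<open>anit\<close> are of this form. The recursion distinguishes whether \<open>p\<close> starts at the first
  letter.\<close>

primrec block_der :: "('l list \<Rightarrow> ('l \<Rightarrow> 'k) \<Rightarrow> 'k) \<Rightarrow> ('l list \<Rightarrow> 'k) \<Rightarrow> 'l list \<Rightarrow> 'k::comm_ring_1"
  where
    "block_der d A [] = 0"
  | "block_der d A (a # w) = deconc (\<lambda>p v. d (a # p) (\<lambda>l. A (l # v))) w +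
      block_der d (\<lambda>v. A (a # v)) w"

lemma block_der_sum:
  "block_der d A w = (\<Sum>j<length w. \<Sum>i\<le>j. d (take (Suc j - i) (drop i w))
     (\<lambda>l. A (take i w @ l # drop (Suc j) w)))"
proof (induction w arbitrary: A)
  case (Cons a w)
  have "(\<Sum>j<length (a # w). \<Sum>i\<le>j. d (take (Suc j - i) (drop i (a # w)))
        (\<lambda>l. A (take i (a # w) @ l # drop (Suc j) (a # w)))) =
      (\<Sum>j<Suc (length w). d (a # take j w) (\<lambda>l. A (l # drop j w))) +
      (\<Sum>j<Suc (length w). \<Sum>i<j. d (take (j - i) (drop i w))
        (\<lambda>l. A (a # take i w @ l # drop j w)))"
    by (simp add: sum.atMost_shift sum.distrib del: sum.lessThan_Suc)
  also have "(\<Sum>j<Suc (length w). \<Sum>i<j. d (take (j - i) (drop i w))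
        (\<lambda>l. A (a # take i w @ l # drop j w))) = block_der d (\<lambda>v. A (a # v)) w"
    unfolding Cons.IH
    by (subst sum.lessThan_Suc_shift) (simp add: lessThan_Suc_atMost del: sum.lessThan_Suc)
  finally show ?case
    by (simp add: deconc_def lessThan_Suc_atMost)
qed simp

lemma block_der_add: "block_der (\<lambda>p f. d p f + d' p f) A w = block_der d A w + block_der d' A w"
  by (induction w arbitrary: A) (simp_all add: deconc_add algebra_simps)

lemma block_der_diff: "block_der (\<lambda>p f. d p f - d' p f) A w = block_der d A w - block_der d' A w"
  by (induction w arbitrary: A) (simp_all add: deconc_diff algebra_simps)

lemma block_der_mult_left:
  assumes "\<And>p. linear_fun (d p)"
  shows "block_der d (\<lambda>v. k * A v) w = k * block_der d A w"
proof (induction w arbitrary: A)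
  case (Cons a w)
  then show ?case
    using assms by (simp add: linear_fun_def deconc_mult_left distrib_left)
qed simp

lemma block_der_plus:
  assumes "\<And>p. linear_fun (d p)"
  shows "block_der d (\<lambda>v. A v + B v) w = block_der d A w + block_der d B w"
proof (induction w arbitrary: A B)
  case (Cons a w)
  then show ?case
    using assms by (simp add: linear_fun_def deconc_add algebra_simps)
qed simp

text \<open>The Leibniz rule, again for arbitrary kernels.\<close>

lemma block_der_deconc:
  assumes "\<And>p. linear_fun (d p)"
  shows "block_der d (deconc K) w = deconc (\<lambda>p q. block_der d (\<lambda>u. K u q) p + block_der d (K p) q)
      w"
proof (induction w arbitrary: K)
  case (Cons a w)
  have d_add: "d p (\<lambda>l. f l + g l) = d p f + d p g" for p f g
    using assms by (auto simp: linear_fun_def)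
  have "deconc (\<lambda>p v. d (a # p) (\<lambda>l. deconc K (l # v))) w =
      deconc (\<lambda>p v. d (a # p) (\<lambda>l. K [] (l # v))) w +
      deconc (\<lambda>x q. deconc (\<lambda>p s. d (a # p) (\<lambda>l. K (l # s) q)) x) w"
    by (simp add: deconc_Cons d_add deconc_add linear_fun_deconc[OF assms] deconc_assoc)
  moreover have "block_der d (\<lambda>v. deconc K (a # v)) w =
      block_der d (\<lambda>v. K [] (a # v)) w +
          deconc (\<lambda>p q. block_der d (\<lambda>u. K (a # u) q) p + block_der d (K (a # p)) q) w"
    by (simp add: deconc_Cons block_der_plus[OF assms] Cons.IH)
  ultimately show ?case
    by (simp add: deconc_Cons deconc_add algebra_simps)
qed simp

text \<open>An automorphism intertwines two derivations as soon as it does so on functions of a single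
  letter, since these generate all functions on words under \<open>mu\<close> and linear combinations. The
  induction makes this precise: splitting off the first factor of the word turns the two sides
  into the same expression, up to the depth one identity on a factor \<open>a # p\<close>, applied to the
  functions \<open>f q\<close> that hold the contribution of the remaining word.\<close>

theorem block_aut_der_commute:
  assumes d: "\<And>p. linear_fun (d p)" and d': "\<And>p. linear_fun (d' p)"
    and letter: "\<And>x p y f. w = x @ p @ y \<Longrightarrow> p \<noteq> [] \<Longrightarrow>
      block_aut c h (\<lambda>s. d s f) p = block_der d' (\<lambda>u. c u * f (h u)) p"
  shows "block_aut c h (block_der d A) w = block_der d' (block_aut c h A) w"
  using letter
proof (induction A w rule: block_aut_induct)
  case (Cons A a w)
  \<comment> \<open>The value at the contracted first letter \<open>m\<close> when the rest \<open>q\<close> of the word is still to be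
    factored.\<close>
  define f where "f q m = block_aut c h (\<lambda>z. A (m # z)) q" for q m
  have inner: "block_aut c h (\<lambda>x. block_der d A (h (a # u) # x)) y =
      deconc (\<lambda>p q. block_aut c h (\<lambda>s. d (h (a # u) # s) (f q)) p) y +
      block_der d' (block_aut c h (\<lambda>z. A (h (a # u) # z))) y" if "u @ y = w" for u y
  proof -
    have "block_aut c h (block_der d (\<lambda>z. A (h (a # u) # z))) y =
        block_der d' (block_aut c h (\<lambda>z. A (h (a # u) # z))) y"
      using that Cons.prems by (intro Cons.IH) (auto, metis append.assoc append_Cons)
    then show ?thesis
      unfolding f_def by (simp add: block_aut_add block_aut_deconc linear_fun_block_aut[OF d])
  qed
  have "block_aut c h (block_der d A) (a # w) =
      deconc (\<lambda>u y. deconc (\<lambda>p q. c (a # u) * block_aut c h (\<lambda>s. d (h (a # u) # s) (f q)) p) y) w +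
      deconc (\<lambda>u y. c (a # u) * block_der d' (block_aut c h (\<lambda>z. A (h (a # u) # z))) y) w"
    by (simp add: block_aut_Cons inner distrib_left deconc_add deconc_mult_left cong: deconc_cong
        del: block_der.simps)
  also have "deconc (\<lambda>u y. deconc
      (\<lambda>p q. c (a # u) * block_aut c h (\<lambda>s. d (h (a # u) # s) (f q)) p) y) w =
      deconc (\<lambda>x q. block_aut c h (\<lambda>s. d s (f q)) (a # x)) w"
    by (simp add: block_aut_Cons deconc_assoc)
  also have "\<dots> = deconc (\<lambda>x q. block_der d' (\<lambda>u. c u * f q (h u)) (a # x)) w"
    using Cons.prems by (intro deconc_cong) (metis append.left_neutral append_Cons list.discI)
  also have "\<dots> = deconc (\<lambda>x q. deconc (\<lambda>p s. d' (a # p) (\<lambda>l. c (l # s) * f q (h (l # s)))) x) w +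
      deconc (\<lambda>x q. block_der d' (\<lambda>u. c (a # u) * f q (h (a # u))) x) w"
    by (simp add: deconc_add)
  also have "\<dots> + deconc (\<lambda>u y. c (a # u) * block_der d' (block_aut c h (\<lambda>z. A (h (a # u) # z))) y)
      w =
      block_der d' (block_aut c h A) (a # w)"
    by (simp add: block_aut_Cons linear_fun_deconc[OF d'] block_der_deconc[OF d']
        block_der_mult_left[OF d'] deconc_add f_def
        deconc_assoc)
  finally show ?case .
qed simp

section \<open>Divided differences\<close>

text \<open>This is \<open>\<D>\<^sub>r(F | z\<^sub>0, \<dots>, z\<^sub>r)\<close> for pairwise distinct nodes. Indexing by the set of nodes
  makes its symmetry implicit.\<close>

definition div_diff :: "('k \<Rightarrow> 'k) \<Rightarrow> 'k set \<Rightarrow> 'k::field" where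
  "div_diff F Z = (\<Sum>z\<in>Z. F z / (\<Prod>k\<in>Z - {z}. k - z))"

lemma div_diff_singleton [simp]: "div_diff F {z} = F z"
  by (simp add: div_diff_def)

lemma div_diff_insert:
  assumes "finite Z" "y \<notin> Z"
  shows "div_diff F (insert y Z) =
    F y / (\<Prod>k\<in>Z. k - y) + (\<Sum>s\<in>Z. F s / ((y - s) * (\<Prod>k\<in>Z - {s}. k - s)))"
proof -
  have "insert y Z - {s} = insert y (Z - {s})" if "s \<in> Z" for s
    using that assms by auto
  moreover have "insert y Z - {y} = Z"
    using assms by auto
  ultimately show ?thesis
    using assms by (simp add: div_diff_def)
qed

text \<open>The terms of the nodes \<open>s \<in> Z\<close> agree by
  \<open>(y - z) / ((y - s) (z - s)) = 1 / (z - s) - 1 / (y - s)\<close>.\<close>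

lemma div_diff_recurrence:
  assumes Z: "finite Z" "y \<notin> Z" "z \<notin> Z" and "y \<noteq> z"
  shows "(y - z) * div_diff F (insert y (insert z Z)) = div_diff F (insert z Z) -
      div_diff F (insert y Z)"
proof -
  have split: "(y - z) * (F s / ((y - s) * (\<Prod>k\<in>insert z Z - {s}. k - s))) =
      F s / ((z - s) * (\<Prod>k\<in>Z - {s}. k - s)) - F s / ((y - s) * (\<Prod>k\<in>Z - {s}. k - s))"
    if "s \<in> Z" for s
  proof -
    have "insert z Z - {s} = insert z (Z - {s})"
      using that Z by auto
    moreover have "(a - b) * (c / (a * (b * q))) = c / (b * q) - c / (a * q)"
      if "a \<noteq> 0" "b \<noteq> 0" for a b c q :: 'a
      using that by (cases "q = 0") (simp_all add: field_simps)
    from this[of "y - s" "z - s" "F s"] have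
      "(y - z) * (F s / ((y - s) * ((z - s) * q))) = F s / ((z - s) * q) - F s / ((y - s) * q)"
          for q
      using that Z by auto
    ultimately show ?thesis
      using Z by simp
  qed
  have "(y - z) * (\<Sum>s\<in>Z. F s / ((y - s) * (\<Prod>k\<in>insert z Z - {s}. k - s))) =
      (\<Sum>s\<in>Z. F s / ((z - s) * (\<Prod>k\<in>Z - {s}. k - s))) -
      (\<Sum>s\<in>Z. F s / ((y - s) * (\<Prod>k\<in>Z - {s}. k - s)))"
    unfolding sum_distrib_left sum_subtractf[symmetric] by (intro sum.cong refl split)
  moreover have "insert z Z - {z} = Z"
    using Z by auto
  moreover have "(y - z) / (z - y) = -1"
    using \<open>y \<noteq> z\<close> by (simp add: field_simps)
  moreover have "(y - z) * (F y / (\<Prod>k\<in>insert z Z. k - y)) =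
      ((y - z) / (z - y)) * (F y / (\<Prod>k\<in>Z. k - y))"
    using Z by simp
  moreover have "(y - z) * (F z / ((y - z) * (\<Prod>k\<in>Z. k - z))) = F z / (\<Prod>k\<in>Z. k - z)"
    using \<open>y \<noteq> z\<close> by simp
  ultimately show ?thesis
    using Z \<open>y \<noteq> z\<close>
    by (simp add: div_diff_insert[of "insert z Z"] div_diff_insert[of Z] distrib_left)
qed

lemma div_diff_translate: "div_diff (\<lambda>t. F (s + t)) ((\<lambda>z. z - s) ` Z) = div_diff F Z"
proof -
  have *: "inj_on (\<lambda>z. z - s) T" for T :: "'a set"
    by (simp add: inj_on_def)
  have "(\<Prod>k\<in>(\<lambda>z. z - s) ` Z - {z - s}. k - (z - s)) = (\<Prod>k\<in>Z - {z}. k - z)" for z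
  proof -
    have "(\<lambda>z. z - s) ` Z - {z - s} = (\<lambda>z. z - s) ` (Z - {z})"
      by auto
    then show ?thesis
      by (simp add: prod.reindex[OF *])
  qed
  then show ?thesis
    by (simp add: div_diff_def sum.reindex[OF *])
qed

text \<open>The two telescoping sums behind the definition of \<open>C(B)\<close>. In each, the terms with index
  below \<open>n\<close> combine into a single divided difference in which the nodes \<open>u a\<close> with \<open>a < n\<close> no
  longer occur (except for \<open>u 0\<close> in the second sum); each step is one use of the recurrence. The
  case \<open>n = p\<close> is used, where one node is left.\<close>

context
  fixes u :: "nat \<Rightarrow> 'k::field" and p :: nat
  assumes inj: "inj_on u {..<p}"
begin

lemma u_less_insert: "n < p \<Longrightarrow> u ` {n..<p} = insert (u n) (u ` {Suc n..<p})"
  unfolding image_insert[symmetric] by (rule arg_cong[of _ _ "image u"]) auto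

lemma u_not_mem: "n < k \<Longrightarrow> n < p \<Longrightarrow> u n \<notin> u ` {k..<p}"
  by (auto dest: inj_onD[OF inj])

lemma div_diff_telescope:
  assumes "1 \<le> n" "n \<le> p" "z \<notin> u ` {..<p}"
  shows "(\<Sum>a<n. ((z - u 0) * div_diff f (insert z (u ` {a..<p})) - div_diff f (u ` {a..<p})) /
      (\<Prod>i=1..<Suc a. u i - u 0)) =
    - div_diff f (insert z (u ` {n..<p})) / (\<Prod>i=1..<n. u i - u 0)"
  using assms(1,2)
proof (induction n rule: nat_induct_at_least)
  case base
  have "z \<noteq> u 0" "z \<notin> u ` {Suc 0..<p}"
    using assms(3) base by auto
  then show ?case
    using base u_not_mem[of 0 1] div_diff_recurrence[of "u ` {1..<p}" z "u 0" f]
    by (simp add: u_less_insert[of 0])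
next
  case (Suc n)
  let ?D = "div_diff f (insert z (u ` {n..<p}))" and ?P = "\<Prod>i=1..<n. u i - u 0"
  have nz: "?P \<noteq> 0" "u n - u 0 \<noteq> 0"
    using Suc.hyps Suc.prems by (auto dest: inj_onD[OF inj])
  have "z \<noteq> u n" "z \<notin> u ` {Suc n..<p}"
    using assms(3) Suc.prems by auto
  then have rec: "(z - u n) * ?D = div_diff f (u ` {n..<p}) -
      div_diff f (insert z (u ` {Suc n..<p}))"
    using Suc.prems u_not_mem[of n "Suc n"] div_diff_recurrence[of "u ` {Suc n..<p}" z "u n" f]
    by (simp add: u_less_insert[of n])
  have "- ?D / ?P + ((z - u 0) * ?D - div_diff f (u ` {n..<p})) / (?P * (u n - u 0)) =
      ((z - u n) * ?D - div_diff f (u ` {n..<p})) / (?P * (u n - u 0))"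
    using nz by (simp add: divide_simps) (simp add: algebra_simps)
  also have "\<dots> = - div_diff f (insert z (u ` {Suc n..<p})) / (?P * (u n - u 0))"
    by (simp add: rec)
  finally show ?case
    using Suc by (simp add: prod.atLeastLessThan_Suc)
qed

lemma div_diff_telescope_0:
  assumes "1 \<le> n" "n \<le> p"
  shows "(\<Sum>a<n. div_diff f (u ` {a..<p}) / (\<Prod>i=1..<Suc a. u i - u 0)) =
    div_diff f (insert (u 0) (u ` {n..<p})) / (\<Prod>i=1..<n. u i - u 0)"
  using assms
proof (induction n rule: nat_induct_at_least)
  case base
  then show ?case
    by (simp add: u_less_insert[of 0])
next
  case (Suc n)
  let ?D = "div_diff f (insert (u 0) (u ` {n..<p}))" and ?P = "\<Prod>i=1..<n. u i - u 0"
  have nz: "?P \<noteq> 0" "u n - u 0 \<noteq> 0"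
    using Suc.hyps Suc.prems by (auto dest: inj_onD[OF inj])
  have rec: "(u 0 - u n) * ?D = div_diff f (u ` {n..<p}) -
      div_diff f (insert (u 0) (u ` {Suc n..<p}))"
    using Suc.prems Suc.hyps nz u_not_mem[of n "Suc n"] u_not_mem[of 0 "Suc n"]
      div_diff_recurrence[of "u ` {Suc n..<p}" "u 0" "u n" f]
    by (simp add: u_less_insert[of n])
  have "?D / ?P + div_diff f (u ` {n..<p}) / (?P * (u n - u 0)) =
      (div_diff f (u ` {n..<p}) - (u 0 - u n) * ?D) / (?P * (u n - u 0))"
    using nz by (simp add: divide_simps) (simp add: algebra_simps)
  also have "\<dots> = div_diff f (insert (u 0) (u ` {Suc n..<p})) / (?P * (u n - u 0))"
    by (simp add: rec)
  finally show ?case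
    using Suc by (simp add: prod.atLeastLessThan_Suc)
qed

end

lemma sum_triangle_shift:
  "(\<Sum>i<j. \<Sum>c\<in>{i..<j}. F i (Suc c)) = (\<Sum>p=1..j. \<Sum>i<p. F i p)" for j :: nat
  unfolding sum.Sigma[OF finite_lessThan ballI[OF finite_atLeastLessThan]]
    sum.Sigma[OF finite_atLeastAtMost ballI[OF finite_lessThan]]
  by (rule sum.reindex_bij_witness[where i = "\<lambda>(p, i). (i, p - 1)" and j = "\<lambda>(i, c). (Suc c, i)"])
      auto

text \<open>The identity to which everything else reduces, with \<open>g p q t\<close> in the role of
  \<open>B(u\<^sub>p - t, \<dots>, u\<^sub>q - t)\<close>. The first sum comes from \<open>amit(B)\<close>, the term \<open>g (Suc i) j (u i)\<close> from
  \<open>anit(B)\<close>, the sum over \<open>c\<close> from \<open>C(B)\<close>, and the right-hand side from conjugating \<open>anit\<close>. The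
  \<open>anit(B)\<close> term is a divided difference with a single node and supplies the missing case \<open>c = i\<close>
  of the second family in \<open>C(B)\<close>; the \<open>amit(B)\<close> term plays, with a different weight, the same role
  for the first family. Collect all terms with the same window \<open>[p, q]\<close>. For \<open>q < m\<close> they cancel
  by \<open>div_diff_telescope\<close> with the extra node \<open>u (Suc q)\<close>, and for \<open>q = m\<close>, where only the second
  family occurs, they add up to the right-hand side by \<open>div_diff_telescope_0\<close>.\<close>

lemma window_identity:
  fixes u :: "nat \<Rightarrow> 'k::field" and g :: "nat \<Rightarrow> nat \<Rightarrow> 'k \<Rightarrow> 'k"
  assumes inj: "inj_on u {..m}" and empty: "\<And>p q t. q < p \<Longrightarrow> g p q t = 0"
  defines "P \<equiv> \<lambda>S. \<Prod>i\<in>{1..m} - S. u i - u 0"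
  shows "(\<Sum>j<m. \<Sum>i\<le>j. g (Suc i) j (u (Suc j)) / P {Suc i..j}) -
    (\<Sum>j\<le>m. \<Sum>i\<le>j. (g (Suc i) j (u i) - (\<Sum>c=Suc i..<j.
        div_diff (g c (j - 1)) (insert (u j) (u ` {i..<c})) -
            div_diff (g (Suc c) j) (u ` {i..<Suc c}))) /
      P {Suc i..j}) =
    - (\<Sum>j\<le>m. g (Suc j) m (u 0) / (\<Prod>i=1..j. u i - u 0))"
proof -
  let ?L = "\<lambda>p q i. div_diff (g p q) (insert (u (Suc q)) (u ` {i..<p}))"
  let ?R = "\<lambda>p q i. div_diff (g p q) (u ` {i..<p})"
  let ?\<Pi> = "\<lambda>n. \<Prod>i=1..<n. u i - u 0"
  let ?Q = "\<lambda>q. \<Prod>i=Suc q..m. u i - u 0"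
  \<comment> \<open>Removing a window from the weight leaves the factors before and after it.\<close>
  have P: "P {p..q} = ?\<Pi> p * ?Q q" if "1 \<le> p" "p \<le> Suc q" "q \<le> m" for p q
  proof -
    have "{1..m} - {p..q} = {1..<p} \<union> {Suc q..m}"
      using that by auto
    then show ?thesis
      unfolding P_def by (simp only:) (rule prod.union_disjoint, use that in auto)
  qed
  have nz: "?\<Pi> n \<noteq> 0" if "n \<le> Suc m" for n
    using that by (auto dest: inj_onD[OF inj])
  have nzQ: "?Q q \<noteq> 0" for q
    by (auto dest: inj_onD[OF inj])
  have "(\<Sum>j\<le>m. \<Sum>i\<le>j. (g (Suc i) j (u i) - (\<Sum>c=Suc i..<j.
        div_diff (g c (j - 1)) (insert (u j) (u ` {i..<c})) -
            div_diff (g (Suc c) j) (u ` {i..<Suc c}))) /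
      P {Suc i..j}) =
    (\<Sum>j\<le>m. \<Sum>i<j. \<Sum>c\<in>{i..<j}. ?R (Suc c) j i / P {Suc i..j}) -
    (\<Sum>j\<le>m. \<Sum>i<j. \<Sum>c\<in>{Suc i..<j}. ?L c (j - 1) i / P {Suc i..j})"
  proof -
    have "(\<Sum>i\<le>j. (g (Suc i) j (u i) - (\<Sum>c=Suc i..<j.
        div_diff (g c (j - 1)) (insert (u j) (u ` {i..<c})) -
            div_diff (g (Suc c) j) (u ` {i..<Suc c}))) /
        P {Suc i..j}) =
      (\<Sum>i<j. \<Sum>c\<in>{i..<j}. ?R (Suc c) j i / P {Suc i..j}) -
      (\<Sum>i<j. \<Sum>c\<in>{Suc i..<j}. ?L c (j - 1) i / P {Suc i..j})" for j
    proof -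
      have "(g (Suc i) j (u i) - (\<Sum>c=Suc i..<j.
          div_diff (g c (j - 1)) (insert (u j) (u ` {i..<c})) -
              div_diff (g (Suc c) j) (u ` {i..<Suc c}))) /
          P {Suc i..j} =
        (\<Sum>c\<in>{i..<j}. ?R (Suc c) j i / P {Suc i..j}) -
        (\<Sum>c\<in>{Suc i..<j}. ?L c (j - 1) i / P {Suc i..j})" if "i < j" for i
        using that
        by (simp add: sum.atLeast_Suc_lessThan[of i j] sum_subtractf diff_divide_distrib
            add_divide_distrib sum_divide_distrib)
      then show ?thesis
        by (simp add: empty sum_subtractf flip: lessThan_Suc_atMost)
    qed
    then show ?thesis
      by (simp add: sum_subtractf)
  qed
  also have "(\<Sum>j\<le>m. \<Sum>i<j. \<Sum>c\<in>{i..<j}. ?R (Suc c) j i / P {Suc i..j}) =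
      (\<Sum>q\<le>m. \<Sum>p=1..q. \<Sum>i<p. ?R p q i / P {Suc i..q})"
    by (simp only: sum_triangle_shift[of "\<lambda>i p. ?R p j i / P {Suc i..j}" j for j])
  also have "(\<Sum>j\<le>m. \<Sum>i<j. \<Sum>c\<in>{Suc i..<j}. ?L c (j - 1) i / P {Suc i..j}) =
      (\<Sum>q<m. \<Sum>p=1..q. \<Sum>i<p. ?L p q i / P {Suc i..Suc q})"
  proof -
    have "(\<Sum>i<Suc q. \<Sum>c\<in>{Suc i..<Suc q}. ?L c q i / P {Suc i..Suc q}) =
        (\<Sum>p=1..q. \<Sum>i<p. ?L p q i / P {Suc i..Suc q})" for q
      using sum_triangle_shift[of "\<lambda>i p. ?L p q i / P {Suc i..Suc q}" q]
      by (simp add: sum.shift_bounds_Suc_ivl del: sum.op_ivl_Suc)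
    then show ?thesis
      by (subst sum.atMost_shift) simp
  qed
  also have "(\<Sum>q\<le>m. \<Sum>p=1..q. \<Sum>i<p. ?R p q i / P {Suc i..q}) =
      (\<Sum>q<m. \<Sum>p=1..q. \<Sum>i<p. ?R p q i / P {Suc i..q}) +
      (\<Sum>p=1..m. \<Sum>i<p. ?R p m i / P {Suc i..m})"
    by (simp flip: lessThan_Suc_atMost)
  finally have *: "(\<Sum>j\<le>m. \<Sum>i\<le>j. (g (Suc i) j (u i) - (\<Sum>c=Suc i..<j.
        div_diff (g c (j - 1)) (insert (u j) (u ` {i..<c})) -
            div_diff (g (Suc c) j) (u ` {i..<Suc c}))) /
      P {Suc i..j}) = \<dots> - (\<Sum>q<m. \<Sum>p=1..q. \<Sum>i<p. ?L p q i / P {Suc i..Suc q})" .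
  have amit: "(\<Sum>j<m. \<Sum>i\<le>j. g (Suc i) j (u (Suc j)) / P {Suc i..j}) =
      (\<Sum>q<m. \<Sum>p=1..q. g p q (u (Suc q)) / P {p..q})"
    using empty by (simp add: sum.atLeast1_atMost_eq flip: lessThan_Suc_atMost)
  \<comment> \<open>A window not reaching the end of the word: everything cancels.\<close>
  have inner: "(\<Sum>i<p. ?L p q i / P {Suc i..Suc q}) - (\<Sum>i<p. ?R p q i / P {Suc i..q}) +
      g p q (u (Suc q)) / P {p..q} = 0" if "q < m" "1 \<le> p" "p \<le> q" for p q
  proof -
    let ?z = "u (Suc q)"
    have "?Q q = (?z - u 0) * ?Q (Suc q)"
      using that by (simp add: prod.atLeast_Suc_atMost[of "Suc q" m])
    moreover have "?z - u 0 \<noteq> 0"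
      using inj that by (auto simp: inj_on_def)
    ultimately have Q: "1 / ?Q (Suc q) = (?z - u 0) / ?Q q"
      using nzQ[of q] by (simp add: field_simps)
    have "?L p q i / P {Suc i..Suc q} - ?R p q i / P {Suc i..q} =
        ((?z - u 0) * ?L p q i - ?R p q i) / ?\<Pi> (Suc i) / ?Q q" if "i < p" for i
    proof -
      have "?L p q i / P {Suc i..Suc q} = ?L p q i / ?\<Pi> (Suc i) * (1 / ?Q (Suc q))"
        using that \<open>q < m\<close> \<open>p \<le> q\<close> by (simp add: P)
      moreover have "?R p q i / P {Suc i..q} = ?R p q i / ?\<Pi> (Suc i) / ?Q q"
        using that \<open>q < m\<close> \<open>p \<le> q\<close> by (simp add: P)
      moreover have "x / a * (d / b) - y / a / b = (d * x - y) / a / b" for a b d x y :: 'k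
        by (simp add: diff_divide_distrib mult.commute)
      ultimately show ?thesis
        by (simp only: Q)
    qed
    then have "(\<Sum>i<p. ?L p q i / P {Suc i..Suc q}) - (\<Sum>i<p. ?R p q i / P {Suc i..q}) =
        (\<Sum>i<p. ((?z - u 0) * ?L p q i - ?R p q i) / ?\<Pi> (Suc i)) / ?Q q"
      by (simp add: sum_divide_distrib flip: sum_subtractf)
    also have "(\<Sum>i<p. ((?z - u 0) * ?L p q i - ?R p q i) / ?\<Pi> (Suc i)) = - g p q ?z / ?\<Pi> p"
    proof -
      have "inj_on u {..<p}" "?z \<notin> u ` {..<p}"
        using that by (auto intro: inj_on_subset[OF inj] dest: inj_onD[OF inj])
      then show ?thesis
        using div_diff_telescope[of u p p ?z "g p q"] that by simp
    qed
    finally show ?thesis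
      using that by (simp add: P)
  qed
  \<comment> \<open>A window reaching the end of the word.\<close>
  have outer: "(\<Sum>i<p. ?R p m i / P {Suc i..m}) = g p m (u 0) / ?\<Pi> p" if "1 \<le> p" "p \<le> m" for p
  proof -
    have "inj_on u {..<p}"
      using that by (auto intro: inj_on_subset[OF inj])
    then show ?thesis
      using div_diff_telescope_0[of u p p "g p m"] that by (simp add: P)
  qed
  have "(\<Sum>j\<le>m. g (Suc j) m (u 0) / (\<Prod>i=1..j. u i - u 0)) =
      (\<Sum>p=1..m. g p m (u 0) / ?\<Pi> p)"
    using empty
    by (simp add: sum.atLeast1_atMost_eq atLeastLessThanSuc_atLeastAtMost
        flip: lessThan_Suc_atMost)
  moreover have "(\<Sum>q<m. \<Sum>p=1..q. g p q (u (Suc q)) / P {p..q}) -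
      (\<Sum>q<m. \<Sum>p=1..q. \<Sum>i<p. ?R p q i / P {Suc i..q}) +
      (\<Sum>q<m. \<Sum>p=1..q. \<Sum>i<p. ?L p q i / P {Suc i..Suc q}) = 0"
    unfolding sum_subtractf[symmetric] sum.distrib[symmetric]
    using inner by (intro sum.neutral) (auto simp: algebra_simps)
  ultimately show ?thesis
    unfolding * amit using outer by (simp add: algebra_simps)
qed

section \<open>Flexion operators on words\<close>

type_synonym 'k word = "('k \<times> 'k) list"

definition shift :: "'k \<Rightarrow> 'k word \<Rightarrow> 'k::field word" where
  "shift t w = map (\<lambda>(x, y). (x - t, y)) w"

text \<open>The two contractions of a block: the sum of its \<open>Y\<close>-entries is attached to the first or to
  the last of its \<open>X\<close>-entries.\<close>

definition mergeF :: "'k word \<Rightarrow> 'k \<times> 'k::field" where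
  "mergeF w = (fst (hd w), sum_list (map snd w))"

definition mergeL :: "'k word \<Rightarrow> 'k \<times> 'k::field" where
  "mergeL w = (fst (last w), sum_list (map snd w))"

definition ganit_word :: "('k word \<Rightarrow> 'k) \<Rightarrow> ('k word \<Rightarrow> 'k) \<Rightarrow> 'k word \<Rightarrow> 'k::field" where
  "ganit_word C = block_aut (\<lambda>u. C (shift (fst (hd u)) (tl u))) mergeF"

text \<open>The depth one parts of the derivations \<open>amit(B)\<close> and \<open>anit(B)\<close>. A block of length one
  contributes \<open>B []\<close>, which has to vanish for the derivations to be the flexion operators.\<close>

definition amit_ker :: "('k word \<Rightarrow> 'k) \<Rightarrow> 'k word \<Rightarrow> ('k \<times> 'k \<Rightarrow> 'k) \<Rightarrow> 'k::field" where
  "amit_ker B p f = B (shift (fst (last p)) (butlast p)) * f (mergeL p)"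

definition anit_ker :: "('k word \<Rightarrow> 'k) \<Rightarrow> 'k word \<Rightarrow> ('k \<times> 'k \<Rightarrow> 'k) \<Rightarrow> 'k::field" where
  "anit_ker B p f = B (shift (fst (hd p)) (tl p)) * f (mergeF p)"

definition pic_word :: "'k word \<Rightarrow> 'k::field" where
  "pic_word w = 1 / prod_list (map fst w)"

text \<open>\<open>1 / ((x\<^sub>1 - x\<^sub>2) (x\<^sub>2 - x\<^sub>3) \<cdots> (x\<^bsub>r-1\<^esub> - x\<^sub>r))\<close>. By \<open>poc_word_shift\<close> below it is the weight
  of a block under \<open>ganit\<^bsub>poc\<^esub>\<close>, the factor \<open>-1 / X\<^sub>1\<close> of \<open>poc\<close> being the link between the first
  two letters of the block.\<close>

fun chain :: "'k word \<Rightarrow> 'k::field" where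
  "chain (a # b # w) = chain (b # w) / (fst a - fst b)"
| "chain _ = 1"

fun poc_word :: "'k word \<Rightarrow> 'k::field" where
  "poc_word [] = 1"
| "poc_word (a # w) = - chain (a # w) / fst a"

text \<open>\<open>C(B)\<close> as an operation on functions on words: the window of letters in which \<open>t\<close> is
  subtracted is \<open>r, \<dots>, m - 1\<close> in the first family of divided differences and \<open>r + 1, \<dots>, m\<close> in the
  second.\<close>

definition C_word :: "('k word \<Rightarrow> 'k) \<Rightarrow> 'k word \<Rightarrow> 'k::field" where
  "C_word B w = (\<Sum>r=1..<length w.
     div_diff (\<lambda>t. B (shift t (take (length w - r) (drop (r - 1) w))))
       (insert 0 (insert (fst (last w)) (set (take (r - 1) (map fst w))))) -
     div_diff (\<lambda>t. B (shift t (drop r w))) (insert 0 (set (take r (map fst w)))))"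

lemma shift_simps [simp]:
  "shift t [] = []" "shift t (a # w) = (fst a - t, snd a) # shift t w"
  "length (shift t w) = length w" "(shift t w = []) = (w = [])"
  "map fst (shift t w) = map (\<lambda>x. x - t) (map fst w)" "map snd (shift t w) = map snd w"
  "shift s (shift t w) = shift (t + s) w"
  "take n (shift t w) = shift t (take n w)" "drop n (shift t w) = shift t (drop n w)"
  "tl (shift t w) = shift t (tl w)"
  by (auto simp: shift_def case_prod_beta take_map drop_map map_tl)

lemma last_shift: "w \<noteq> [] \<Longrightarrow> fst (last (shift t w)) = fst (last w) - t"
  by (simp add: shift_def last_map case_prod_beta)

lemma mergeF_single [simp]: "mergeF [a] = a"
  by (simp add: mergeF_def)

text \<open>Compatibility of \<^const>\<open>mergeF\<close> with nested blocks; the hypothesis of \<open>block_aut_comp\<close>.\<close>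

lemma mergeF_mergeF:
  assumes "[] \<notin> set bs" "bs \<noteq> []"
  shows "mergeF (map mergeF bs) = mergeF (concat bs)"
proof -
  have "sum_list (map snd (map mergeF bs)) = sum_list (map snd (concat bs))"
    by (induction bs) (simp_all add: mergeF_def)
  then show ?thesis
    using assms by (cases bs) (auto simp: mergeF_def)
qed

lemma sum_snd_mergeF: "sum_list (map (snd \<circ> mergeF) bs) = sum_list (map snd (concat bs))"
  by (induction bs) (simp_all add: mergeF_def)

lemma ganit_word_Nil [simp]: "ganit_word C A [] = A []"
  by (simp add: ganit_word_def)

lemma ganit_word_Cons: "ganit_word C A (a # w) =
  deconc (\<lambda>u v. C (shift (fst a) u) * ganit_word C (\<lambda>x. A (mergeF (a # u) # x)) v) w"
  by (simp add: ganit_word_def block_aut_Cons)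

lemma deconc_map: "deconc K (map f w) = deconc (\<lambda>u v. K (map f u) (map f v)) w"
  by (simp add: deconc_def take_map drop_map)

text \<open>The weights only involve differences of \<open>X\<close>-entries.\<close>

lemma ganit_word_shift: "ganit_word C (\<lambda>u. A (shift t u)) w = ganit_word C A (shift t w)"
proof (induction A w rule: block_aut_induct)
  case (Cons A a w)
  have "ganit_word C A (shift t (a # w)) = deconc (\<lambda>u v. C (shift (fst a - t) (shift t u)) *
      ganit_word C (\<lambda>x. A (mergeF ((fst a - t, snd a) # shift t u) # x)) (shift t v)) w"
    unfolding shift_def by (simp add: ganit_word_Cons deconc_map case_prod_beta shift_def)
  also have "\<dots> = deconc (\<lambda>u v. C (shift (fst a) u) *
      ganit_word C (\<lambda>x. A (mergeF ((fst a - t, snd a) # shift t u) # shift t x)) v) w"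
    by (intro deconc_cong arg_cong2[of _ _ _ _ "(*)"]) (simp, simp only: Cons.IH[symmetric])
  also have "\<dots> = ganit_word C (\<lambda>u. A (shift t u)) (a # w)"
    by (simp add: ganit_word_Cons mergeF_def)
  finally show ?case ..
qed simp

section \<open>The inverse of ganit for pic\<close>

lemma poc_word_shift: "poc_word (shift (fst a) u) = chain (a # u)"
proof -
  have chain_shift: "chain (shift t u) = chain u" for t and u :: "'a word"
    by (induction u rule: chain.induct) auto
  show ?thesis
  proof (cases u)
    case (Cons b w)
    have "- (x / (fst b - fst a)) = x / (fst a - fst b)" for x
      by (metis minus_diff_eq minus_divide_right)
    then show ?thesis
      using chain_shift[of "fst a" "b # w"] by (simp add: Cons)
  qed simp
qed

text \<open>Summing over the first block \<open>u\<close> of \<open>w = u @ y\<close>, the induction hypothesis kills all \<open>y\<close> of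
  length at least two: after contraction the first letter of \<open>y\<close> keeps its \<open>X\<close>-entry, so the link
  from the first block to \<open>y\<close> is a common factor. The two remaining terms, \<open>y = []\<close> and \<open>y\<close> the
  last letter \<open>b\<close>, are opposite: moving \<open>b\<close> out of the first block exchanges the factor
  \<open>1 / (b - a)\<close> of the weight for the link \<open>1 / (a - b)\<close>.\<close>

lemma ganit_word_pic_chain:
  assumes "distinct (map fst w)"
  shows "ganit_word pic_word chain w = (if length w \<le> 1 then 1 else 0)"
  using assms
proof (induction w rule: length_induct)
  case (1 w)
  show ?case
  proof (cases w)
    case (Cons a v)
    \<comment> \<open>The chain of \<open>a # u\<close> contracted and continued by \<open>y\<close>, summed over the factorisations of
      \<open>y\<close>.\<close>
    have head: "ganit_word pic_word (\<lambda>x. chain (mergeF (a # u) # x)) y =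
        (if y = [] then 1 else if length y = 1 then 1 / (fst a - fst (hd y)) else 0)"
      if y: "u @ y = v" for u y
    proof (cases "y = []")
      case False
      have "ganit_word pic_word (\<lambda>x. chain (mergeF (a # u) # x)) y =
          ganit_word pic_word (\<lambda>x. 1 / (fst a - fst (hd y)) * chain x) y"
        unfolding ganit_word_def
      proof (rule block_aut_cong)
        fix bs assume "concat bs = y" "[] \<notin> set bs"
        then show "chain (mergeF (a # u) # map mergeF bs) =
            1 / (fst a - fst (hd y)) * chain (map mergeF bs)"
          using False by (cases bs) (auto simp: mergeF_def)
      qed
      also have "\<dots> = 1 / (fst a - fst (hd y)) * ganit_word pic_word chain y"
        by (simp only: ganit_word_def block_aut_mult_left)
      also have "ganit_word pic_word chain y = (if length y \<le> 1 then 1 else 0)"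
        using 1 y Cons by auto
      finally show ?thesis
        using False by (cases y) auto
    qed simp
    have "ganit_word pic_word chain w = deconc (\<lambda>u y. pic_word (shift (fst a) u) *
        (if y = [] then 1 else if length y = 1 then 1 / (fst a - fst (hd y)) else 0)) v"
      by (simp add: Cons ganit_word_Cons head cong: deconc_cong)
    also have "\<dots> = (if v = [] then 1 else 0)"
    proof (cases v rule: rev_cases)
      case (snoc v' b)
      have split: "deconc K (v' @ [b]) = K (v' @ [b]) [] + K v' [b] +
          (\<Sum>i<length v'. K (take i v') (drop i v' @ [b]))" for K :: "'a word \<Rightarrow> 'a word \<Rightarrow> 'a"
        by (simp add: deconc_def flip: lessThan_Suc_atMost)
      have "pic_word (shift (fst a) (v' @ [b])) = pic_word (shift (fst a) v') / (fst b - fst a)"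
        by (simp add: pic_word_def shift_def case_prod_beta)
      also have "\<dots> = - (pic_word (shift (fst a) v') / (fst a - fst b))"
        by (metis minus_diff_eq minus_divide_right)
      finally have "pic_word (shift (fst a) (v' @ [b])) =
          - (pic_word (shift (fst a) v') / (fst a - fst b))" .
      then show ?thesis
        by (simp add: snoc split)
    qed (simp add: pic_word_def)
    finally show ?thesis
      by (simp add: Cons)
  qed simp
qed

text \<open>By \<open>block_aut_comp\<close> the composition is the automorphism whose weight is the transform of
  \<^const>\<open>chain\<close>, that is, the automorphism that only uses blocks of length one.\<close>

theorem ganit_word_pic_poc:
  assumes "distinct (map fst w)"
  shows "ganit_word pic_word (ganit_word poc_word A) w = A w"
proof -
  have "ganit_word poc_word A = block_aut chain mergeF A" for A :: "'a word \<Rightarrow> 'a"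
  proof
    fix w show "ganit_word poc_word A w = block_aut chain mergeF A w"
      by (induction A w rule: block_aut_induct)
        (auto simp: ganit_word_def block_aut_Cons poc_word_shift intro!: deconc_cong)
  qed
  then have "ganit_word pic_word (ganit_word poc_word A) w =
      block_aut (ganit_word pic_word chain) mergeF A w"
    by (simp add: ganit_word_def block_aut_comp mergeF_mergeF)
  also have "\<dots> = A w"
    using assms
  proof (induction A w rule: block_aut_induct)
    case (Cons A a w)
    have "block_aut (ganit_word pic_word chain) mergeF A (a # w) =
        deconc (\<lambda>u v. (if u = [] then 1 else 0) *
          block_aut (ganit_word pic_word chain) mergeF (\<lambda>x. A (mergeF (a # u) # x)) v) w"
      using Cons.prems by (auto simp: block_aut_Cons ganit_word_pic_chain image_Un intro!:
          deconc_cong)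
    also have "\<dots> = block_aut (ganit_word pic_word chain) mergeF (\<lambda>x. A (mergeF [a] # x)) w"
      by (cases w) (simp_all add: deconc_Cons)
    also have "\<dots> = A (a # w)"
      using Cons.IH[of "[]" w] Cons.prems by simp
    finally show ?case .
  qed simp
  finally show ?thesis .
qed

section \<open>Conjugating arit by ganit for pic\<close>

abbreviation arit_ker :: "('k word \<Rightarrow> 'k) \<Rightarrow> 'k word \<Rightarrow> ('k \<times> 'k \<Rightarrow> 'k) \<Rightarrow> 'k::field" where
  "arit_ker B p f \<equiv> amit_ker B p f - anit_ker B p f"

lemma linear_fun_amit_ker: "linear_fun (amit_ker B p)" and linear_fun_anit_ker:
    "linear_fun (anit_ker B p)"
  by (simp_all add: linear_fun_def amit_ker_def anit_ker_def algebra_simps)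

lemma linear_fun_diff: "linear_fun S \<Longrightarrow> linear_fun T \<Longrightarrow> linear_fun (\<lambda>f. S f - T f)"
  and linear_fun_plus: "linear_fun S \<Longrightarrow> linear_fun T \<Longrightarrow> linear_fun (\<lambda>f. S f + T f)"
  by (simp_all add: linear_fun_def algebra_simps)

text \<open>The depth one part of \<open>amit(B)\<close> factors a word into a prefix, where \<open>B\<close> is evaluated, and a
  last letter, which is kept. By multiplicativity its transform therefore cuts the word into a
  prefix, where the transform of \<open>B\<close> is evaluated, and a single block holding the kept letter as
  its first letter. On the right-hand side this letter is regarded as the last letter of the
  prefix, which displays the transform as the part of \<open>amit\<close> applied to the first letters of a
  word.\<close>

lemma ganit_word_amit_ker:
  fixes B :: "'k::field word \<Rightarrow> 'k" and C :: "'k word \<Rightarrow> 'k" and f :: "'k \<times> 'k \<Rightarrow> 'k"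
  shows "ganit_word C (\<lambda>s. amit_ker B s f) (a # w) =
    deconc (\<lambda>p v. amit_ker (ganit_word C B) (a # p)
      (\<lambda>l. C (shift (fst l) v) * f (mergeF (l # v)))) w"
proof -
  let ?c = "\<lambda>u. C (shift (fst (hd u)) (tl u))"
  define K where "K s1 s2 = (if length s2 = 1 then
      B (shift (fst (hd s2)) s1) * f (fst (hd s2), sum_list (map snd s1) + snd (hd s2)) else 0)"
    for s1 s2 :: "'k word"
  \<comment> \<open>The kernel \<open>K\<close> only sees the cut before the last letter.\<close>
  have amit_ker_deconc: "amit_ker B s f = deconc K s" if "s \<noteq> []" for s
  proof (cases s rule: rev_cases)
    case (snoc s' b)
    have "deconc K (s' @ [b]) = K s' [b]"
      by (simp add: deconc_def K_def flip: lessThan_Suc_atMost)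
    then show ?thesis
      by (simp add: snoc K_def amit_ker_def mergeL_def)
  qed (use that in simp)
  have "ganit_word C (\<lambda>s. amit_ker B s f) (a # w) = ganit_word C (deconc K) (a # w)"
    unfolding ganit_word_def by (rule block_aut_cong, rule amit_ker_deconc) auto
  also have "\<dots> = deconc (\<lambda>p1 p2. if p2 = [] then 0 else ganit_word C (\<lambda>s1. ?c p2 *
      (B (shift (fst (hd p2)) s1) * f (fst (hd p2), sum_list (map snd (s1 @ p2))))) p1) (a # w)"
  proof -
    have "block_aut ?c mergeF (K s1) p2 = (if p2 = [] then 0 else ?c p2 *
        (B (shift (fst (hd p2)) s1) * f (fst (hd p2), sum_list (map snd (s1 @ p2)))))" for s1 p2
      using block_aut_letter[of ?c mergeF
          "\<lambda>l. B (shift (fst l) s1) * f (fst l, sum_list (map snd s1) + snd l)" p2]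
      by (simp add: K_def[abs_def] mergeF_def)
    then show ?thesis
      unfolding ganit_word_def block_aut_deconc by (intro deconc_cong) auto
  qed
  also have "\<dots> = deconc (\<lambda>p1 p2. if p2 = [] then 0 else
      ganit_word C B (shift (fst (hd p2)) p1) *
          (?c p2 * f (fst (hd p2), sum_list (map snd (p1 @ p2)))))
      (a # w)"
  proof (intro deconc_cong if_cong refl)
    fix p1 p2 :: "'k word"
    have "ganit_word C (\<lambda>s1. ?c p2 *
        (B (shift (fst (hd p2)) s1) * f (fst (hd p2), sum_list (map snd (s1 @ p2))))) p1 =
      ganit_word C (\<lambda>s1. (?c p2 * f (fst (hd p2), sum_list (map snd (p1 @ p2)))) *
        B (shift (fst (hd p2)) s1)) p1"
      unfolding ganit_word_def by (rule block_aut_cong) (auto simp: sum_snd_mergeF)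
    also have "\<dots> = (?c p2 * f (fst (hd p2), sum_list (map snd (p1 @ p2)))) *
        ganit_word C B (shift (fst (hd p2)) p1)"
      unfolding ganit_word_shift[of C B, symmetric] by
          (simp only: ganit_word_def block_aut_mult_left)
    finally show "ganit_word C (\<lambda>s1. ?c p2 *
        (B (shift (fst (hd p2)) s1) * f (fst (hd p2), sum_list (map snd (s1 @ p2))))) p1 =
      ganit_word C B (shift (fst (hd p2)) p1) *
          (?c p2 * f (fst (hd p2), sum_list (map snd (p1 @ p2))))"
      by (simp add: mult.commute)
  qed
  also have "\<dots> = deconc (\<lambda>p1 p2. if p2 = [] then 0 else
      (\<lambda>p1 e v. ganit_word C B (shift (fst e) p1) * (C (shift (fst e) v) *
        f (fst e, sum_list (map snd (p1 @ e # v))))) p1 (hd p2) (tl p2)) (a # w)"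
    by (intro deconc_cong if_cong refl) simp
  also have "\<dots> = deconc (\<lambda>p v. amit_ker (ganit_word C B) (a # p)
      (\<lambda>l. C (shift (fst l) v) * f (mergeF (l # v)))) w"
  proof (subst deconc_last_first, intro deconc_cong)
    fix p v
    have "sum_list (map snd (butlast (a # p) @ last (a # p) # v)) =
        sum_list (map snd (a # p)) + sum_list (map snd v)"
      by (cases p rule: rev_cases) (simp_all add: butlast_append ac_simps)
    then show "ganit_word C B (shift (fst (last (a # p))) (butlast (a # p))) *
        (C (shift (fst (last (a # p))) v) *
          f (fst (last (a # p)), sum_list (map snd (butlast (a # p) @ last (a # p) # v)))) =
      amit_ker (ganit_word C B) (a # p) (\<lambda>l. C (shift (fst l) v) * f (mergeF (l # v)))"
      by (simp add: amit_ker_def mergeL_def mergeF_def add.assoc[symmetric]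
          del: butlast.simps last.simps)
  qed
  finally show ?thesis .
qed

text \<open>The letter kept by \<open>anit(B)\<close> is the first one, so the contracted letter is the same in all
  terms and factors out; what is left is a sum over the first block alone.\<close>

lemma ganit_word_anit_ker:
  "ganit_word C (\<lambda>s. anit_ker B s f) (a # w) = f (mergeF (a # w)) *
    deconc (\<lambda>u v. C (shift (fst a) u) * ganit_word C B (shift (fst a) v)) w"
proof -
  have "ganit_word C (\<lambda>x. anit_ker B (mergeF (a # u) # x) f) v =
      f (mergeF (a # w)) * ganit_word C B (shift (fst a) v)" if "u @ v = w" for u v
  proof -
    have "ganit_word C (\<lambda>x. anit_ker B (mergeF (a # u) # x) f) v =
        ganit_word C (\<lambda>x. f (mergeF (a # w)) * B (shift (fst a) x)) v"
      unfolding ganit_word_def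
    proof (rule block_aut_cong)
      fix bs assume "concat bs = v" "[] \<notin> set bs"
      then have "mergeF (mergeF (a # u) # map mergeF bs) = mergeF (a # w)"
        using mergeF_mergeF[of "(a # u) # bs"] that by simp
      then show "anit_ker B (mergeF (a # u) # map mergeF bs) f =
          f (mergeF (a # w)) * B (shift (fst a) (map mergeF bs))"
        by (simp add: anit_ker_def mult.commute) (simp add: mergeF_def)
    qed
    also have "\<dots> = f (mergeF (a # w)) * ganit_word C B (shift (fst a) v)"
      unfolding ganit_word_shift[symmetric, of C B] by
          (simp only: ganit_word_def block_aut_mult_left)
    finally show ?thesis .
  qed
  then have "ganit_word C (\<lambda>s. anit_ker B s f) (a # w) = deconc (\<lambda>u v. f (mergeF (a # w)) *
      (C (shift (fst a) u) * ganit_word C B (shift (fst a) v))) w"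
    unfolding ganit_word_Cons by (intro deconc_cong) (simp add: ac_simps)
  then show ?thesis
    by (simp only: deconc_mult_left)
qed

lemma pic_word_shift: "pic_word (shift x w) = 1 / prod_list (map (\<lambda>l. fst l - x) w)"
  by (simp add: pic_word_def shift_def case_prod_beta comp_def)

lemma prod_list_upt: "prod_list (map f [i..<j]) = prod f {i..<j}"
  by (simp flip: prod.distinct_set_conv_list)

text \<open>What remains of the depth one identity once the terms of \<open>ganit_word_amit_ker\<close> are removed:
  all terms evaluate \<open>f\<close> at the letter \<open>mergeF p\<close>, and comparing coefficients gives
  \<open>window_identity\<close> for the \<open>X\<close>-entries \<open>u i\<close>. In the bookkeeping, a contraction of the window
  \<open>i + 1, \<dots>, j\<close> removes the factors \<open>u k - u 0\<close> of that window from the weight.\<close>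

lemma letter_remainder:
  fixes L :: "nat \<Rightarrow> 'k::field \<times> 'k" and m :: nat and B :: "'k word \<Rightarrow> 'k"
    and f :: "'k \<times> 'k \<Rightarrow> 'k"
  defines "p \<equiv> map L [0..<Suc m]" and "w \<equiv> map L [Suc 0..<Suc m]"
  defines "\<phi> \<equiv> \<lambda>u. pic_word (shift (fst (hd u)) (tl u)) * f (mergeF u)"
  assumes inj: "inj_on (\<lambda>i. fst (L i)) {..m}" and B: "B [] = 0"
  shows "- (f (mergeF p) * deconc (\<lambda>u v. pic_word (shift (fst (L 0)) u) * B (shift (fst (L 0)) v))
      w) =
    block_der (amit_ker B) (\<lambda>v. \<phi> (L 0 # v)) w - block_der (anit_ker (\<lambda>u. B u - C_word B u)) \<phi> p"
proof -
  define u where "u i = fst (L i)" for i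
  define g where "g i j t = B (shift t (map L [i..<Suc j]))" for i j t
  define P where "P S = (\<Prod>i\<in>{1..m} - S. u i - u 0)" for S
  let ?f = "f (mergeF p)"
  have P: "P {Suc i..j} = prod_list (map (\<lambda>k. u k - u 0) [Suc 0..<Suc i]) *
      prod_list (map (\<lambda>k. u k - u 0) [Suc j..<Suc m])" if "i \<le> j" "j \<le> m" for i j
  proof -
    have "{1..m} - {Suc i..j} = {Suc 0..<Suc i} \<union> {Suc j..<Suc m}"
      using that by auto
    then show ?thesis
      unfolding P_def prod_list_upt by (simp only:) (rule prod.union_disjoint, use that in auto)
  qed
  have sum_split: "sum_list (map (snd \<circ> L) [i..<j]) + sum_list (map (snd \<circ> L) [j..<k]) =
      sum_list (map (snd \<circ> L) [i..<k])" if "i \<le> j" "j \<le> k" for i j k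
    using that by (metis le_add_diff_inverse map_append sum_list_append upt_add_eq_append)
  \<comment> \<open>The kept letter \<open>L (Suc j)\<close> has to stay in the weight, so only \<open>i + 1, \<dots>, j\<close> are removed.\<close>
  have amit: "amit_ker B (take (Suc j - i) (drop i w))
      (\<lambda>l. \<phi> (L 0 # take i w @ l # drop (Suc j) w)) =
      ?f * (g (Suc i) j (u (Suc j)) / P {Suc i..j})" if "i \<le> j" "j < m" for i j
  proof -
    have s: "take (Suc j - i) (drop i w) = map L [Suc i..<Suc j] @ [L (Suc j)]"
    proof -
      have "[Suc i..<Suc (Suc j)] = [Suc i..<Suc j] @ [Suc j]"
        using that by simp
      then show ?thesis
        using that by (simp add: w_def take_map drop_map Suc_diff_le del: upt_Suc)
    qed
    have t: "take i w = map L [Suc 0..<Suc i]" "drop (Suc j) w = map L [Suc (Suc j)..<Suc m]"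
      using that by (simp_all add: w_def take_map drop_map)
    have "sum_list (map (snd \<circ> L) [0..<Suc m]) = snd (L 0) +
        sum_list (map (snd \<circ> L) [Suc 0..<Suc i]) + sum_list (map (snd \<circ> L) [Suc i..<Suc j]) +
        snd (L (Suc j)) + sum_list (map (snd \<circ> L) [Suc (Suc j)..<Suc m])"
      using that sum_split[of 0 "Suc 0" "Suc m"] sum_split[of "Suc 0" "Suc i" "Suc m"]
        sum_split[of "Suc i" "Suc j" "Suc m"] sum_split[of "Suc j" "Suc (Suc j)" "Suc m"]
      by (simp add: add.assoc del: upt_Suc) (simp add: add.assoc)
    then have "mergeF (L 0 # take i w @ mergeL (map L [Suc i..<Suc j] @ [L (Suc j)]) #
        drop (Suc j) w) = mergeF p"
      by (simp add: t mergeF_def mergeL_def p_def upt_conv_Cons[of 0] ac_simps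
          del: upt_Suc)
    moreover have "pic_word (shift (u 0) (take i w @ mergeL (map L [Suc i..<Suc j] @ [L (Suc j)]) #
        drop (Suc j) w)) = 1 / P {Suc i..j}"
      using that P[of i j] by (simp add: t pic_word_shift mergeL_def u_def comp_def
          upt_conv_Cons[of "Suc j"] del: upt_Suc)
    ultimately show ?thesis
      by (simp add: s amit_ker_def \<phi>_def g_def u_def del: upt_Suc)
  qed
  \<comment> \<open>Here \<open>L i\<close> is kept. The nodes of \<open>C(B)\<close> at the shifted window are translates of the \<open>u k\<close>,
    and the node \<open>0\<close> is the translate of \<open>u i\<close>.\<close>
  have anit: "anit_ker (\<lambda>u. B u - C_word B u) (take (Suc j - i) (drop i p))
        (\<lambda>l. \<phi> (take i p @ l # drop (Suc j) p)) =
      ?f * ((g (Suc i) j (u i) - (\<Sum>c=Suc i..<j.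
        div_diff (g c (j - 1)) (insert (u j) (u ` {i..<c})) -
            div_diff (g (Suc c) j) (u ` {i..<Suc c}))) /
        P {Suc i..j})" if "i \<le> j" "j \<le> m" for i j
  proof -
    let ?s = "map L [i..<Suc j]" and ?t = "map L [Suc i..<Suc j]"
    have s: "take (Suc j - i) (drop i p) = ?s"
      using that by (simp add: p_def take_map drop_map del: upt_Suc)
    have s': "?s = L i # ?t"
      using that by (simp add: upt_conv_Cons del: upt_Suc)
    have t: "take i p = map L [0..<i]" "drop (Suc j) p = map L [Suc j..<Suc m]"
      using that by (simp_all add: p_def take_map drop_map del: upt_Suc)
    have "sum_list (map (snd \<circ> L) [0..<i]) + sum_list (map (snd \<circ> L) [i..<Suc j]) +
        sum_list (map (snd \<circ> L) [Suc j..<Suc m]) = sum_list (map (snd \<circ> L) [0..<Suc m])"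
      using that by (simp add: sum_split del: upt_Suc)
    then have "mergeF (take i p @ mergeF ?s # drop (Suc j) p) = mergeF p"
      using that unfolding t
      by (cases "i = 0") (simp_all add: mergeF_def p_def upt_conv_Cons[of 0] hd_append hd_map
          add.assoc del: upt_Suc)
    moreover have "pic_word (shift (fst (hd (take i p @ mergeF ?s # drop (Suc j) p)))
        (tl (take i p @ mergeF ?s # drop (Suc j) p))) = 1 / P {Suc i..j}"
    proof (cases i)
      case 0
      then show ?thesis
        using that P[of 0 j] by (simp add: t pic_word_shift mergeF_def u_def comp_def hd_map del:
            upt_Suc)
    next
      case (Suc k)
      have "[0..<i] = 0 # [Suc 0..<i]"
        by (simp add: Suc upt_conv_Cons del: upt_Suc)
      moreover have "[Suc 0..<Suc i] = [Suc 0..<i] @ [i]"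
        by (simp add: Suc)
      ultimately show ?thesis
        using that P[of i j]
        by (simp add: t pic_word_shift mergeF_def u_def comp_def hd_map mult.assoc del: upt_Suc)
    qed
    moreover have "C_word B (shift (u i) ?t) = (\<Sum>c=Suc i..<j.
        div_diff (g c (j - 1)) (insert (u j) (u ` {i..<c})) -
            div_diff (g (Suc c) j) (u ` {i..<Suc c}))"
    proof -
      have "C_word B (shift (u i) ?t) = (\<Sum>r=1..<j-i.
          div_diff (g (i + r) (j - 1)) (insert (u j) (u ` {i..<i + r})) -
          div_diff (g (Suc (i + r)) j) (u ` {i..<Suc (i + r)}))"
        unfolding C_word_def
      proof (intro sum.cong arg_cong2[of _ _ _ _ "(-)"])
        fix r assume r: "r \<in> {1..<j - i}"
        have nodes: "insert 0 (set (take n (map fst (shift (u i) ?t)))) =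
            (\<lambda>z. z - u i) ` u ` {i..<Suc (i + n)}" if "n \<le> j - i" for n
        proof -
          have "set (take n (map fst (shift (u i) ?t))) = (\<lambda>z. z - u i) ` u ` {Suc i..<Suc (i + n)}"
            using that \<open>i \<le> j\<close> by (simp add: take_map u_def image_image del: upt_Suc)
          moreover have "{i..<Suc (i + n)} = insert i {Suc i..<Suc (i + n)}"
            by auto
          ultimately show ?thesis
            by simp
        qed
        have last: "fst (last (shift (u i) ?t)) = u j - u i"
          using r by (auto simp: last_shift u_def)
        have "Suc (i + (r - 1)) = i + r" "r - 1 \<le> j - i"
          using r by auto
        then have "insert 0 (insert (fst (last (shift (u i) ?t)))
            (set (take (r - 1) (map fst (shift (u i) ?t))))) =
            (\<lambda>z. z - u i) ` insert (u j) (u ` {i..<i + r})"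
          unfolding last insert_commute[of 0] image_insert using nodes[of "r - 1"] by metis
        moreover have "(\<lambda>t. B (shift t (take (length (shift (u i) ?t) - r)
            (drop (r - 1) (shift (u i) ?t))))) = (\<lambda>t. g (i + r) (j - 1) (u i + t))"
          using r by (auto simp: g_def take_map drop_map fun_eq_iff simp del: upt_Suc)
        ultimately show "div_diff (\<lambda>t. B (shift t (take (length (shift (u i) ?t) - r)
            (drop (r - 1) (shift (u i) ?t)))))
            (insert 0 (insert (fst (last (shift (u i) ?t)))
              (set (take (r - 1) (map fst (shift (u i) ?t)))))) =
            div_diff (g (i + r) (j - 1)) (insert (u j) (u ` {i..<i + r}))"
          by (simp only: div_diff_translate)
        have "(\<lambda>t. B (shift t (drop r (shift (u i) ?t)))) = (\<lambda>t. g (Suc (i + r)) j (u i + t))"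
          using r by (auto simp: g_def take_map drop_map fun_eq_iff simp del: upt_Suc)
        moreover have "r \<le> j - i"
          using r by simp
        ultimately show "div_diff (\<lambda>t. B (shift t (drop r (shift (u i) ?t))))
            (insert 0 (set (take r (map fst (shift (u i) ?t))))) =
            div_diff (g (Suc (i + r)) j) (u ` {i..<Suc (i + r)})"
          using r by (simp only: nodes[of r] div_diff_translate)
      qed (simp del: upt_Suc)
      also have "\<dots> = (\<Sum>c=Suc i..<j.
          div_diff (g c (j - 1)) (insert (u j) (u ` {i..<c})) -
              div_diff (g (Suc c) j) (u ` {i..<Suc c}))"
        by (rule sum.reindex_bij_witness[of _ "\<lambda>c. c - i" "\<lambda>r. i + r"]) auto
      finally show ?thesis .
    qed
    ultimately show ?thesis
      unfolding s by (simp add: anit_ker_def \<phi>_def g_def u_def s' del: upt_Suc)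
  qed
  have prefix: "deconc (\<lambda>s v. pic_word (shift (fst (L 0)) s) * B (shift (fst (L 0)) v)) w =
      (\<Sum>j\<le>m. g (Suc j) m (u 0) / (\<Prod>i=1..j. u i - u 0))"
  proof -
    have "pic_word (shift (fst (L 0)) (take j w)) * B (shift (fst (L 0)) (drop j w)) =
        g (Suc j) m (u 0) / (\<Prod>i=1..j. u i - u 0)" if "j \<le> m" for j
      using that prod_list_upt[of "\<lambda>k. u k - u 0" 1 "Suc j"]
      by (simp add: w_def take_map drop_map pic_word_shift g_def u_def comp_def
          atLeastLessThanSuc_atLeastAtMost del: upt_Suc)
    then show ?thesis
      by (simp add: deconc_def w_def del: upt_Suc)
  qed
  have "inj_on u {..m}"
    using inj by (simp add: u_def[abs_def])
  from window_identity[OF this, of g] have "(\<Sum>j<m. \<Sum>i\<le>j. g (Suc i) j (u (Suc j)) / P {Suc i..j}) -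
    (\<Sum>j\<le>m. \<Sum>i\<le>j. (g (Suc i) j (u i) - (\<Sum>c=Suc i..<j.
        div_diff (g c (j - 1)) (insert (u j) (u ` {i..<c})) -
            div_diff (g (Suc c) j) (u ` {i..<Suc c}))) /
      P {Suc i..j}) =
    - (\<Sum>j\<le>m. g (Suc j) m (u 0) / (\<Prod>i=1..j. u i - u 0))"
    by (simp add: P_def g_def B)
  moreover have "block_der (amit_ker B) (\<lambda>v. \<phi> (L 0 # v)) w =
      ?f * (\<Sum>j<m. \<Sum>i\<le>j. g (Suc i) j (u (Suc j)) / P {Suc i..j})"
    unfolding block_der_sum sum_distrib_left using amit by (intro sum.cong) (auto simp: w_def)
  moreover have "block_der (anit_ker (\<lambda>u. B u - C_word B u)) \<phi> p =
      ?f * (\<Sum>j\<le>m. \<Sum>i\<le>j. (g (Suc i) j (u i) - (\<Sum>c=Suc i..<j.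
        div_diff (g c (j - 1)) (insert (u j) (u ` {i..<c})) -
            div_diff (g (Suc c) j) (u ` {i..<Suc c}))) /
      P {Suc i..j})"
    unfolding block_der_sum sum_distrib_left using anit by (intro sum.cong) (auto simp: p_def)
  ultimately show ?thesis
    unfolding prefix by (simp flip: right_diff_distrib)
qed

lemma letter_identity:
  fixes B :: "'k::field word \<Rightarrow> 'k"
  assumes dist: "distinct (map fst p)" and "p \<noteq> []" and B: "B [] = 0"
  shows "ganit_word pic_word (\<lambda>s. arit_ker B s f) p =
    block_der (\<lambda>q f. arit_ker (ganit_word pic_word B) q f +
        anit_ker (C_word (ganit_word pic_word B)) q f)
      (\<lambda>u. pic_word (shift (fst (hd u)) (tl u)) * f (mergeF u)) p"
proof -
  obtain a w where p: "p = a # w"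
    using \<open>p \<noteq> []\<close> by (cases p) auto
  define L where "L i = p ! i" for i
  define m where "m = length w"
  have Lp: "p = map L [0..<Suc m]"
    unfolding L_def m_def using map_nth[of p] by (simp add: p del: upt_Suc)
  then have Lw: "w = map L [Suc 0..<Suc m]" and La: "a = L 0"
    by (simp_all add: p upt_conv_Cons del: upt_Suc)
  have inj: "inj_on (\<lambda>i. fst (L i)) {..m}"
    using dist by (subst (asm) Lp)
      (simp add: distinct_map comp_def atLeast0LessThan lessThan_Suc_atMost del: upt_Suc)
  let ?B = "ganit_word pic_word B" and ?\<phi> =
      "\<lambda>u. pic_word (shift (fst (hd u)) (tl u)) * f (mergeF u)"
  have "ganit_word pic_word (\<lambda>s. arit_ker B s f) p = ganit_word pic_word (\<lambda>s. amit_ker B s f) p -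
      ganit_word pic_word (\<lambda>s. anit_ker B s f) p"
    by (simp add: ganit_word_def block_aut_diff)
  also have "\<dots> = deconc (\<lambda>q v. amit_ker ?B (a # q) (\<lambda>l. ?\<phi> (l # v))) w +
      (block_der (amit_ker ?B) (\<lambda>v. ?\<phi> (a # v)) w -
          block_der (anit_ker (\<lambda>u. ?B u - C_word ?B u)) ?\<phi> p)"
    using letter_remainder[OF inj, of ?B f] B
    unfolding Lp[symmetric] Lw[symmetric] La[symmetric] by
        (simp add: p ganit_word_amit_ker ganit_word_anit_ker)
  also have "\<dots> = block_der (amit_ker ?B) ?\<phi> p - block_der (anit_ker (\<lambda>u. ?B u - C_word ?B u)) ?\<phi> p"
    by (simp add: p)
  also have "\<dots> = block_der (\<lambda>q f. arit_ker ?B q f + anit_ker (C_word ?B) q f) ?\<phi> p"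
    unfolding block_der_diff[symmetric] by (simp add: anit_ker_def algebra_simps)
  finally show ?thesis .
qed

text \<open>That is, \<open>ganit\<^bsub>pic\<^esub>\<close> conjugates \<open>arit(B)\<close> into \<open>urit(B')\<close> for \<open>B' = ganit\<^bsub>pic\<^esub>(B)\<close>. By
  \<open>block_aut_der_commute\<close> only functions of one letter have to be considered.\<close>

theorem ganit_word_pic_arit:
  fixes A B :: "'k::field word \<Rightarrow> 'k"
  assumes "distinct (map fst w)" and "B [] = 0"
  shows "ganit_word pic_word (block_der (arit_ker B) A) w =
    block_der (arit_ker (ganit_word pic_word B)) (ganit_word pic_word A) w +
        block_der (anit_ker (C_word (ganit_word pic_word B))) (ganit_word pic_word A) w"
proof -
  have "ganit_word pic_word (block_der (arit_ker B) A) w =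
      block_der (\<lambda>q f. arit_ker (ganit_word pic_word B) q f +
          anit_ker (C_word (ganit_word pic_word B)) q f) (ganit_word pic_word A) w"
    unfolding ganit_word_def
  proof (rule block_aut_der_commute)
    fix x p y f assume "w = x @ p @ y" "p \<noteq> []"
    then show "block_aut (\<lambda>u. pic_word (shift (fst (hd u)) (tl u))) mergeF (\<lambda>s. arit_ker B s f) p =
      block_der (\<lambda>q f. arit_ker (block_aut (\<lambda>u. pic_word (shift (fst (hd u)) (tl u))) mergeF B) q
          f +
        anit_ker (C_word (block_aut (\<lambda>u. pic_word (shift (fst (hd u)) (tl u))) mergeF B)) q f)
        (\<lambda>u. pic_word (shift (fst (hd u)) (tl u)) * f (mergeF u)) p"
      using assms letter_identity[of p B f] by (simp add: ganit_word_def)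
  qed (intro linear_fun_diff linear_fun_plus linear_fun_amit_ker linear_fun_anit_ker)+
  then show ?thesis
    by (simp add: block_der_add)
qed

section \<open>Substitution into rational functions\<close>

text \<open>The graph of \<^const>\<open>rsubst\<close> \<open>\<sigma>\<close> on the local ring of the fractions whose denominator survives
  \<open>\<sigma>\<close>. As a relation it is closed under the field operations (division by elements with nonzero
  image), which transports identities along \<open>\<sigma>\<close> without separate definedness proofs.\<close>

definition specializes :: "(var \<Rightarrow> ratfun) \<Rightarrow> ratfun \<Rightarrow> ratfun \<Rightarrow> bool" where
  "specializes \<sigma> f g \<longleftrightarrow> (\<exists>p q. psubst \<sigma> q \<noteq> 0 \<and> f = Fract p q \<and> g = psubst \<sigma> p / psubst \<sigma> q)"

lemma rsubst_specializes: "specializes \<sigma> f g \<Longrightarrow> rsubst \<sigma> f = g"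
  by (auto simp: specializes_def rsubst_Fract)

lemma specializes_unique: "specializes \<sigma> f g \<Longrightarrow> specializes \<sigma> f g' \<Longrightarrow> g = g'"
  using rsubst_specializes by blast

lemma rf_const_1: "rf_const 1 = 1"
  by (simp add: rf_const_def rf_of_poly_def single_one fract_collapse)

lemma psubst_1 [simp]: "psubst \<sigma> 1 = 1"
  using psubst_single[of \<sigma> 0 1] by (simp add: rf_const_1)

lemma specializes_of_poly: "specializes \<sigma> (rf_of_poly p) (psubst \<sigma> p)"
  unfolding specializes_def rf_of_poly_def by (rule exI[of _ p], rule exI[of _ 1]) simp

lemma specializes_const: "specializes \<sigma> (rf_const c) (rf_const c)"
  using specializes_of_poly[of \<sigma> "Poly_Mapping.single 0 c"] by
      (simp add: rf_const_def[symmetric] psubst_single)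

lemma specializes_0 [simp]: "specializes \<sigma> 0 0" and specializes_1 [simp]: "specializes \<sigma> 1 1"
  using specializes_const[of \<sigma> 0] specializes_const[of \<sigma> 1] by
      (simp_all add: rf_const_simps rf_const_1)

lemma specializes_var: "specializes \<sigma> (rf_var v) (\<sigma> v)"
  using specializes_of_poly[of \<sigma> "Poly_Mapping.single (Poly_Mapping.single v 1) 1"]
  by (simp add: rf_var_def psubst_single rf_const_1)

lemma specializes_add:
  assumes "specializes \<sigma> f g" "specializes \<sigma> f' g'"
  shows "specializes \<sigma> (f + f') (g + g')"
proof -
  obtain p q p' q' where *: "psubst \<sigma> q \<noteq> 0" "f = Fract p q" "g = psubst \<sigma> p / psubst \<sigma> q"
    "psubst \<sigma> q' \<noteq> 0" "f' = Fract p' q'" "g' = psubst \<sigma> p' / psubst \<sigma> q'"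
    using assms unfolding specializes_def by blast
  then have "q \<noteq> 0" "q' \<noteq> 0"
    by auto
  then have "f + f' = Fract (p * q' + p' * q) (q * q')"
    using * by simp
  moreover have "g + g' = psubst \<sigma> (p * q' + p' * q) / psubst \<sigma> (q * q')"
    using * by (simp add: psubst_add psubst_mult field_simps)
  moreover have "psubst \<sigma> (q * q') \<noteq> 0"
    using * by (simp add: psubst_mult)
  ultimately show ?thesis
    unfolding specializes_def by blast
qed

lemma specializes_mult:
  assumes "specializes \<sigma> f g" "specializes \<sigma> f' g'"
  shows "specializes \<sigma> (f * f') (g * g')"
proof -
  obtain p q p' q' where *: "psubst \<sigma> q \<noteq> 0" "f = Fract p q" "g = psubst \<sigma> p / psubst \<sigma> q"
    "psubst \<sigma> q' \<noteq> 0" "f' = Fract p' q'" "g' = psubst \<sigma> p' / psubst \<sigma> q'"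
    using assms unfolding specializes_def by blast
  have "psubst \<sigma> (q * q') \<noteq> 0" "f * f' = Fract (p * p') (q * q')"
    "g * g' = psubst \<sigma> (p * p') / psubst \<sigma> (q * q')"
    using * by (simp_all add: psubst_mult)
  then show ?thesis
    unfolding specializes_def by blast
qed

lemma specializes_uminus: "specializes \<sigma> f g \<Longrightarrow> specializes \<sigma> (- f) (- g)"
proof -
  have "rf_const 1 + rf_const (- 1) = 0"
    using rf_const_simps(2)[of 1 "-1"] by (simp add: rf_const_simps(1))
  then have "rf_const (- 1) = - 1"
    by (metis rf_const_1 minus_unique)
  then show "specializes \<sigma> f g \<Longrightarrow> specializes \<sigma> (- f) (- g)"
    using specializes_mult[OF specializes_const[of \<sigma> "-1"], of f g] by simp
qed

lemma specializes_diff: "specializes \<sigma> f g \<Longrightarrow> specializes \<sigma> f' g' \<Longrightarrow> specializes \<sigma> (f - f') (g - g')"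
  using specializes_add[of \<sigma> f g "- f'" "- g'"] specializes_uminus[of \<sigma> f' g'] by simp

lemma specializes_divide:
  assumes "specializes \<sigma> f g" "specializes \<sigma> f' g'" "g' \<noteq> 0"
  shows "specializes \<sigma> (f / f') (g / g')"
proof -
  obtain p q where *: "psubst \<sigma> q \<noteq> 0" "f' = Fract p q" "g' = psubst \<sigma> p / psubst \<sigma> q"
    using assms(2) unfolding specializes_def by blast
  then have "psubst \<sigma> p \<noteq> 0"
    using \<open>g' \<noteq> 0\<close> by auto
  moreover have "inverse f' = Fract q p" "inverse g' = psubst \<sigma> q / psubst \<sigma> p"
    using * by simp_all
  ultimately have "specializes \<sigma> (inverse f') (inverse g')"
    unfolding specializes_def by blast
  then show ?thesis
    using specializes_mult[OF assms(1)] by (simp add: divide_inverse)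
qed

lemma specializes_sum:
  assumes "\<And>i. i \<in> I \<Longrightarrow> specializes \<sigma> (f i) (g i)"
  shows "specializes \<sigma> (sum f I) (sum g I)"
  using assms by (induction I rule: infinite_finite_induct) (auto intro: specializes_add)

lemma specializes_prod:
  assumes "\<And>i. i \<in> I \<Longrightarrow> specializes \<sigma> (f i) (g i)"
  shows "specializes \<sigma> (prod f I) (prod g I)"
  using assms by (induction I rule: infinite_finite_induct) (auto intro: specializes_mult)

lemma specializes_power: "specializes \<sigma> f g \<Longrightarrow> specializes \<sigma> (f ^ n) (g ^ n)"
  by (induction n) (auto intro: specializes_mult)

lemma specializes_sum_list: "list_all2 (specializes \<sigma>) xs ys \<Longrightarrow>
    specializes \<sigma> (sum_list xs) (sum_list ys)"
  by (induction rule: list_all2_induct) (auto intro: specializes_add)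

lemma specializes_prod_list: "list_all2 (specializes \<sigma>) xs ys \<Longrightarrow>
    specializes \<sigma> (prod_list xs) (prod_list ys)"
  by (induction rule: list_all2_induct) (auto intro: specializes_mult)

text \<open>Substitutions compose. A fraction that survives \<open>\<sigma>'\<close> also survives \<open>\<tau>\<close>, since \<open>\<sigma>\<close> maps the
  \<open>\<tau>\<close>-value of the denominator to its \<open>\<sigma>'\<close>-value.\<close>

lemma specializes_rsubst:
  assumes f: "specializes \<sigma>' f g" and v: "\<And>v. specializes \<sigma> (\<tau> v) (\<sigma>' v)"
  shows "specializes \<sigma> (rsubst \<tau> f) g"
proof -
  have poly: "specializes \<sigma> (psubst \<tau> p) (psubst \<sigma>' p)" for p
    unfolding psubst_def by (intro specializes_sum specializes_mult specializes_prod
        specializes_power specializes_const v)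
  obtain p q where *: "psubst \<sigma>' q \<noteq> 0" "f = Fract p q" "g = psubst \<sigma>' p / psubst \<sigma>' q"
    using f unfolding specializes_def by blast
  then have "psubst \<tau> q \<noteq> 0"
    using poly[of q] specializes_unique[OF specializes_0] by metis
  then show ?thesis
    using * by (simp add: rsubst_Fract specializes_divide poly)
qed

section \<open>Naturality of the operators on words\<close>

definition specializes_letter :: "(var \<Rightarrow> ratfun) \<Rightarrow> ratfun \<times> ratfun \<Rightarrow> ratfun \<times> ratfun \<Rightarrow> bool" where
  "specializes_letter \<sigma> l l' \<longleftrightarrow> specializes \<sigma> (fst l) (fst l') \<and> specializes \<sigma> (snd l) (snd l')"

text \<open>The words at which elements of \<open>\<L>\<^sub>r\<close> can be evaluated. This class is stable under all
  flexions, since differences of distinct entries are nonzero and distinct for a fixed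
  subtrahend.\<close>

definition generic :: "'k::field word \<Rightarrow> bool" where
  "generic w \<longleftrightarrow> distinct (map fst w) \<and> 0 \<notin> fst ` set w"

text \<open>Compatibility of a function on words with substitutions. All operators on words preserve it,
  as they are built from field operations, contractions and shifts whose denominators do not
  vanish at generic words.\<close>

definition natural :: "(ratfun word \<Rightarrow> ratfun) \<Rightarrow> bool" where
  "natural F \<longleftrightarrow> (\<forall>\<sigma> w w'. list_all2 (specializes_letter \<sigma>) w w' \<longrightarrow> generic w' \<longrightarrow>
      specializes \<sigma> (F w) (F w'))"

lemma naturalD: "natural F \<Longrightarrow> list_all2 (specializes_letter \<sigma>) w w' \<Longrightarrow> generic w' \<Longrightarrow>
    specializes \<sigma> (F w) (F w')"
  by (simp add: natural_def)

lemma specializes_letter_shift: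
  "list_all2 (specializes_letter \<sigma>) w w' \<Longrightarrow> specializes \<sigma> t t' \<Longrightarrow>
      list_all2 (specializes_letter \<sigma>) (shift t w) (shift t' w')"
  by (induction rule: list_all2_induct) (auto simp: specializes_letter_def specializes_diff)

lemma specializes_letter_nth: "list_all2 (specializes_letter \<sigma>) w w' \<Longrightarrow> i < length w' \<Longrightarrow>
    specializes_letter \<sigma> (w ! i) (w' ! i)"
  by (simp add: list_all2_conv_all_nth)

lemma specializes_map_fst: "list_all2 (specializes_letter \<sigma>) w w' \<Longrightarrow>
    list_all2 (specializes \<sigma>) (map fst w) (map fst w')"
  and specializes_map_snd: "list_all2 (specializes_letter \<sigma>) w w' \<Longrightarrow>
      list_all2 (specializes \<sigma>) (map snd w) (map snd w')"
  by (auto simp: list_all2_conv_all_nth specializes_letter_def)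

lemma specializes_letter_hd: "list_all2 (specializes_letter \<sigma>) w w' \<Longrightarrow> w' \<noteq> [] \<Longrightarrow>
    specializes_letter \<sigma> (hd w) (hd w')"
  by (cases w; cases w') auto

lemma specializes_letter_last:
    "list_all2 (specializes_letter \<sigma>) w w' \<Longrightarrow> w' \<noteq> [] \<Longrightarrow> specializes_letter \<sigma> (last w) (last w')"
  using specializes_letter_nth[of \<sigma> w w' "length w' - 1"]
  by (cases "w = []") (auto simp: last_conv_nth dest: list_all2_lengthD)

lemma specializes_letter_mergeF:
    "list_all2 (specializes_letter \<sigma>) w w' \<Longrightarrow> w' \<noteq> [] \<Longrightarrow> specializes_letter \<sigma> (mergeF w) (mergeF w')"
  and specializes_letter_mergeL:
      "list_all2 (specializes_letter \<sigma>) w w' \<Longrightarrow> w' \<noteq> [] \<Longrightarrow>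
          specializes_letter \<sigma> (mergeL w) (mergeL w')"
  using specializes_letter_hd specializes_letter_last by
      (auto simp: specializes_letter_def mergeF_def mergeL_def specializes_sum_list
          specializes_map_snd)

lemma specializes_letter_butlast:
    "list_all2 (specializes_letter \<sigma>) w w' \<Longrightarrow>
        list_all2 (specializes_letter \<sigma>) (butlast w) (butlast w')"
  by (simp add: butlast_conv_take list_all2_lengthD)

lemma specializes_letter_tl: "list_all2 (specializes_letter \<sigma>) w w' \<Longrightarrow>
    list_all2 (specializes_letter \<sigma>) (tl w) (tl w')"
  by (cases w; cases w') auto

lemma generic_append: "generic (u @ v) \<longleftrightarrow> generic u \<and> generic v \<and> fst ` set u \<inter> fst ` set v = {}"
  by (auto simp: generic_def)

lemma generic_Cons: "generic (a # v) \<longleftrightarrow> fst a \<noteq> 0 \<and> fst a \<notin> fst ` set v \<and> generic v"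
  by (auto simp: generic_def)

lemma generic_Nil [simp]: "generic []"
  by (simp add: generic_def)

lemma generic_take: "generic w \<Longrightarrow> generic (take i w)"
  and generic_drop: "generic w \<Longrightarrow> generic (drop i w)"
  using generic_append[of "take i w" "drop i w"] by simp_all

lemma generic_shift:
  assumes "generic w" "t \<notin> fst ` set w"
  shows "generic (shift t w)"
proof -
  have "distinct (map (\<lambda>x. x - t) (map fst w))"
    using assms(1)
    by (simp add: generic_def distinct_map[of "\<lambda>x. x - t"] inj_on_def del: map_map)
  moreover have "0 \<notin> fst ` set (shift t w)"
    using assms(2) by (auto simp: shift_def image_iff case_prod_beta)
  ultimately show ?thesis
    by (simp add: generic_def del: map_map)
qed

lemma generic_shift_tl: "generic w \<Longrightarrow> generic (shift (fst (hd w)) (tl w))"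
  by (cases w) (auto simp: generic_Cons intro: generic_shift)

lemma generic_shift_butlast: "generic w \<Longrightarrow> generic (shift (fst (last w)) (butlast w))"
  by (cases w rule: rev_cases) (auto simp: generic_append intro: generic_shift)

lemma generic_mergeF: "generic (u @ s @ v) \<Longrightarrow> s \<noteq> [] \<Longrightarrow> generic (u @ mergeF s # v)"
  by (cases s) (auto simp: generic_append generic_Cons mergeF_def)

lemma generic_mergeL: "generic (u @ s @ v) \<Longrightarrow> s \<noteq> [] \<Longrightarrow> generic (u @ mergeL s # v)"
  by (cases s rule: rev_cases) (auto simp: generic_append generic_Cons mergeL_def)

lemma generic_map_mergeF: "generic (concat bs) \<Longrightarrow> [] \<notin> set bs \<Longrightarrow> generic (map mergeF bs)"
proof (induction bs)
  case (Cons b bs)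
  have "hd b' \<in> set (concat bs)" if "b' \<in> set bs" for b'
  proof -
    have "hd b' \<in> set b'"
      using that Cons.prems(2) by (intro list.set_sel) auto
    then show ?thesis
      using that by auto
  qed
  then have "fst ` set (map mergeF bs) \<subseteq> fst ` set (concat bs)"
    unfolding set_map image_image mergeF_def fst_conv by blast
  moreover have "generic (mergeF b # concat bs)"
    using Cons.prems generic_mergeF[of "[]" b "concat bs"] by auto
  moreover have "generic (map mergeF bs)"
    using Cons by (simp add: generic_append)
  ultimately show ?case
    unfolding list.map generic_Cons by blast
qed simp

lemma factor_split:
  assumes "i \<le> j" "j < length w"
  shows "take i w @ take (Suc j - i) (drop i w) @ drop (Suc j) w = w"
    and "take (Suc j - i) (drop i w) \<noteq> []"
proof -
  have "drop (Suc j) w = drop (Suc j - i) (drop i w)"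
    using assms by simp
  then show "take i w @ take (Suc j - i) (drop i w) @ drop (Suc j) w = w"
    by (simp only: append_take_drop_id)
qed (use assms in auto)

lemma natural_add: "natural F \<Longrightarrow> natural G \<Longrightarrow> natural (\<lambda>w. F w + G w)"
  and natural_diff: "natural F \<Longrightarrow> natural G \<Longrightarrow> natural (\<lambda>w. F w - G w)"
  by (simp_all add: natural_def specializes_add specializes_diff)

lemma natural_deconc: "natural F \<Longrightarrow> natural G \<Longrightarrow> natural (deconc (\<lambda>u v. F u * G v))"
  unfolding natural_def[of "deconc _"] deconc_def
proof (intro allI impI)
  fix \<sigma> w w'
  assume *: "natural F" "natural G" "list_all2 (specializes_letter \<sigma>) w w'" "generic w'"
  show "specializes \<sigma> (\<Sum>i\<le>length w. F (take i w) * G (drop i w))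
      (\<Sum>i\<le>length w'. F (take i w') * G (drop i w'))"
    unfolding list_all2_lengthD[OF *(3)]
    by (intro specializes_sum specializes_mult naturalD[OF *(1)] naturalD[OF *(2)] list_all2_takeI
        list_all2_dropI generic_take generic_drop *(3,4))
qed

lemma natural_block_der_amit_ker:
  assumes "natural B" "natural A"
  shows "natural (block_der (amit_ker B) A)"
  unfolding natural_def
proof (intro allI impI)
  fix \<sigma> w w' assume *: "list_all2 (specializes_letter \<sigma>) w w'" "generic w'"
  have "specializes \<sigma>
      (amit_ker B (take (Suc j - i) (drop i w)) (\<lambda>l. A (take i w @ l # drop (Suc j) w)))
      (amit_ker B (take (Suc j - i) (drop i w')) (\<lambda>l. A (take i w' @ l # drop (Suc j) w')))"
    if "i \<le> j" "j < length w'" for i j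
    unfolding amit_ker_def
  proof (intro specializes_mult naturalD[OF assms(1)] naturalD[OF assms(2)])
    show "generic (take i w' @ mergeL (take (Suc j - i) (drop i w')) # drop (Suc j) w')"
      using * factor_split[OF that] by (intro generic_mergeL) auto
    show "list_all2 (specializes_letter \<sigma>)
        (take i w @ mergeL (take (Suc j - i) (drop i w)) # drop (Suc j) w)
        (take i w' @ mergeL (take (Suc j - i) (drop i w')) # drop (Suc j) w')"
      using * factor_split[OF that] by (auto intro!: list_all2_appendI specializes_letter_mergeL)
    show "list_all2 (specializes_letter \<sigma>)
        (shift (fst (last (take (Suc j - i) (drop i w)))) (butlast (take (Suc j - i) (drop i w))))
        (shift (fst (last (take (Suc j - i) (drop i w'))))
            (butlast (take (Suc j - i) (drop i w'))))"
    proof (intro specializes_letter_shift specializes_letter_butlast list_all2_takeI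
        list_all2_dropI *(1))
      have "specializes_letter \<sigma> (last (take (Suc j - i) (drop i w)))
          (last (take (Suc j - i) (drop i w')))"
        by (intro specializes_letter_last list_all2_takeI list_all2_dropI *(1)
            factor_split[OF that])
      then show "specializes \<sigma> (fst (last (take (Suc j - i) (drop i w))))
          (fst (last (take (Suc j - i) (drop i w'))))"
        by (simp only: specializes_letter_def)
    qed
  qed (use * in \<open>intro generic_shift_butlast generic_take generic_drop\<close>)
  then show "specializes \<sigma> (block_der (amit_ker B) A w) (block_der (amit_ker B) A w')"
    unfolding block_der_sum list_all2_lengthD[OF *(1)] by (intro specializes_sum) auto
qed

lemma natural_block_der_anit_ker:
  assumes "natural B" "natural A"
  shows "natural (block_der (anit_ker B) A)"
  unfolding natural_def
proof (intro allI impI)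
  fix \<sigma> w w' assume *: "list_all2 (specializes_letter \<sigma>) w w'" "generic w'"
  have "specializes \<sigma>
      (anit_ker B (take (Suc j - i) (drop i w)) (\<lambda>l. A (take i w @ l # drop (Suc j) w)))
      (anit_ker B (take (Suc j - i) (drop i w')) (\<lambda>l. A (take i w' @ l # drop (Suc j) w')))"
    if "i \<le> j" "j < length w'" for i j
    unfolding anit_ker_def
  proof (intro specializes_mult naturalD[OF assms(1)] naturalD[OF assms(2)])
    show "generic (take i w' @ mergeF (take (Suc j - i) (drop i w')) # drop (Suc j) w')"
      using * factor_split[OF that] by (intro generic_mergeF) auto
    show "list_all2 (specializes_letter \<sigma>)
        (take i w @ mergeF (take (Suc j - i) (drop i w)) # drop (Suc j) w)
        (take i w' @ mergeF (take (Suc j - i) (drop i w')) # drop (Suc j) w')"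
      using * factor_split[OF that] by (auto intro!: list_all2_appendI specializes_letter_mergeF)
    show "list_all2 (specializes_letter \<sigma>)
        (shift (fst (hd (take (Suc j - i) (drop i w)))) (tl (take (Suc j - i) (drop i w))))
        (shift (fst (hd (take (Suc j - i) (drop i w')))) (tl (take (Suc j - i) (drop i w'))))"
    proof (intro specializes_letter_shift specializes_letter_tl list_all2_takeI list_all2_dropI
        *(1))
      have "specializes_letter \<sigma> (hd (take (Suc j - i) (drop i w)))
          (hd (take (Suc j - i) (drop i w')))"
        by (intro specializes_letter_hd list_all2_takeI list_all2_dropI *(1) factor_split[OF that])
      then show "specializes \<sigma> (fst (hd (take (Suc j - i) (drop i w))))
          (fst (hd (take (Suc j - i) (drop i w'))))"
        by (simp only: specializes_letter_def)
    qed
  qed (use * in \<open>intro generic_shift_tl generic_take generic_drop\<close>)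
  then show "specializes \<sigma> (block_der (anit_ker B) A w) (block_der (anit_ker B) A w')"
    unfolding block_der_sum list_all2_lengthD[OF *(1)] by (intro specializes_sum) auto
qed

text \<open>The hypothesis on \<open>A\<close> and \<open>A'\<close> is restricted to contracted words because the curried
  functions that arise in the induction are not themselves natural.\<close>

lemma specializes_ganit_word:
  assumes "natural C" "list_all2 (specializes_letter \<sigma>) w w'" "generic w'"
    and "\<And>bs bs'. list_all2 (list_all2 (specializes_letter \<sigma>)) bs bs' \<Longrightarrow> concat bs' = w' \<Longrightarrow>
        [] \<notin> set bs' \<Longrightarrow>
      specializes \<sigma> (A (map mergeF bs)) (A' (map mergeF bs'))"
  shows "specializes \<sigma> (ganit_word C A w) (ganit_word C A' w')"
  using assms(2-)
proof (induction A w arbitrary: A' w' rule: block_aut_induct)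
  case (Nil A)
  then show ?case
    using Nil(3)[of "[]" "[]"] by simp
next
  case (Cons A a w)
  obtain a' v' where w': "w' = a' # v'" "specializes_letter \<sigma> a a'"
      "list_all2 (specializes_letter \<sigma>) w v'"
    using Cons.prems(1) by (cases w') auto
  have len: "length w = length v'"
    using w'(3) by (rule list_all2_lengthD)
  show ?case
    unfolding w'(1) ganit_word_Cons deconc_def len
  proof (intro specializes_sum specializes_mult naturalD[OF assms(1)])
    fix i assume "i \<in> {..length v'}"
    let ?u = "take i w" and ?u' = "take i v'"
    show "list_all2 (specializes_letter \<sigma>) (shift (fst a) ?u) (shift (fst a') ?u')"
      using w' by (intro specializes_letter_shift list_all2_takeI)
          (auto simp: specializes_letter_def)
    show "generic (shift (fst a') ?u')"
      using Cons.prems(2) by (intro generic_shift generic_take)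
        (auto simp: w' generic_Cons dest: in_set_takeD)
    show "specializes \<sigma> (ganit_word C (\<lambda>x. A (mergeF (a # ?u) # x)) (drop i w))
        (ganit_word C (\<lambda>x. A' (mergeF (a' # ?u') # x)) (drop i v'))"
    proof (rule Cons.IH)
      show "?u @ drop i w = w" "list_all2 (specializes_letter \<sigma>) (drop i w) (drop i v')"
          "generic (drop i v')"
        using w' Cons.prems(2) by (simp_all add: generic_Cons generic_drop)
      fix bs bs'
      assume "list_all2 (list_all2 (specializes_letter \<sigma>)) bs bs'" "concat bs' = drop i v'"
          "[] \<notin> set bs'"
      then show "specializes \<sigma> (A (mergeF (a # ?u) # map mergeF bs))
          (A' (mergeF (a' # ?u') # map mergeF bs'))"
        using Cons.prems(3)[of "(a # ?u) # bs" "(a' # ?u') # bs'"] w' by simp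
    qed
  qed
qed

lemma natural_ganit_word:
  assumes "natural C" "natural A"
  shows "natural (ganit_word C A)"
  unfolding natural_def
proof (intro allI impI specializes_ganit_word[OF assms(1)] naturalD[OF assms(2)])
  fix \<sigma> w w' and bs bs' :: "ratfun word list"
  assume *: "generic w'" "list_all2 (list_all2 (specializes_letter \<sigma>)) bs bs'" "concat bs' = w'"
      "[] \<notin> set bs'"
  then show "generic (map mergeF bs')"
    using generic_map_mergeF by blast
  show "list_all2 (specializes_letter \<sigma>) (map mergeF bs) (map mergeF bs')"
    using *(2,4) by (induction rule: list_all2_induct) (auto intro: specializes_letter_mergeF)
qed

lemma natural_pic_word: "natural pic_word"
  unfolding natural_def pic_word_def
  by (intro allI impI specializes_divide specializes_prod_list specializes_map_fst specializes_1)
    (auto simp: generic_def prod_list_zero_iff)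

lemma natural_poc_word: "natural poc_word"
proof -
  have chain: "specializes \<sigma> (chain w) (chain w')" if "list_all2 (specializes_letter \<sigma>) w w'"
      "generic w'" for \<sigma> w w'
    using that
  proof (induction w arbitrary: w' rule: chain.induct)
    case (1 a b w)
    then obtain a' b' v' where "w' = a' # b' # v'" "specializes_letter \<sigma> a a'"
        "specializes_letter \<sigma> b b'"
      "list_all2 (specializes_letter \<sigma>) w v'"
      by (auto simp: list_all2_Cons1)
    then show ?case
      using 1 by (auto intro!: specializes_divide specializes_diff simp: specializes_letter_def
          generic_Cons)
  qed (auto simp: list_all2_Cons1)
  show ?thesis
    unfolding natural_def
  proof (intro allI impI)
    fix \<sigma> w w' assume *: "list_all2 (specializes_letter \<sigma>) w w'" "generic w'"
    then show "specializes \<sigma> (poc_word w) (poc_word w')"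
      using chain[OF *] by (cases w; cases w')
          (auto intro!: specializes_divide specializes_uminus simp: specializes_letter_def
              generic_Cons)
  qed
qed

lemma divD_eq_div_diff:
  assumes "distinct zs"
  shows "divD F zs = div_diff F (set zs)"
proof -
  have bij: "bij_betw ((!) zs) {..<length zs} (set zs)"
    using assms by (rule bij_betw_nth) auto
  have "(\<Prod>k\<in>{..<length zs} - {s}. zs ! k - zs ! s) = (\<Prod>k\<in>set zs - {zs ! s}. k - zs ! s)"
    if "s < length zs" for s
  proof (rule prod.reindex_bij_betw)
    show "bij_betw ((!) zs) ({..<length zs} - {s}) (set zs - {zs ! s})"
      using bij_betw_DiffI[OF bij, of "{s}" "{zs ! s}"] that by (simp add: bij_betw_def)
  qed
  then have "divD F zs = (\<Sum>s<length zs. F (zs ! s) / (\<Prod>k\<in>set zs - {zs ! s}. k - zs ! s))"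
    by (simp add: divD_def)
  also have "\<dots> = div_diff F (set zs)"
    unfolding div_diff_def by (rule sum.reindex_bij_betw[OF bij])
  finally show ?thesis .
qed

lemma specializes_div_diff:
  assumes zs: "list_all2 (specializes \<sigma>) zs zs'" and dist: "distinct zs'"
    and F: "\<And>z z'. specializes \<sigma> z z' \<Longrightarrow> z' \<in> set zs' \<Longrightarrow> specializes \<sigma> (F z) (F' z')"
  shows "specializes \<sigma> (div_diff F (set zs)) (div_diff F' (set zs'))"
proof -
  have len: "length zs = length zs'"
    using zs by (rule list_all2_lengthD)
  have nth: "specializes \<sigma> (zs ! i) (zs' ! i)" if "i < length zs'" for i
    using zs that len by (simp add: list_all2_nthD)
  have "distinct zs"
    unfolding distinct_conv_nth len using nth specializes_unique dist by (metis nth_eq_iff_index_eq)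
  then show ?thesis
    unfolding divD_eq_div_diff[OF \<open>distinct zs\<close>, symmetric] divD_eq_div_diff[OF dist, symmetric]
        divD_def len
    using dist by (auto intro!: specializes_sum specializes_divide F nth specializes_prod
        specializes_diff simp: nth_eq_iff_index_eq)
qed

text \<open>In both families of divided differences the nodes are distinct and no node is an entry of
  the window.\<close>

lemma generic_nodes:
  assumes "generic w"
  shows "r < length w \<Longrightarrow> 1 \<le> r \<Longrightarrow> z \<in>
      insert 0 (insert (fst (last w)) (set (take (r - 1) (map fst w)))) \<Longrightarrow>
      generic (shift z (take (length w - r) (drop (r - 1) w)))"
    and "r < length w \<Longrightarrow> 1 \<le> r \<Longrightarrow> distinct (0 # take (r - 1) (map fst w) @ [fst (last w)])"
    and "z \<in> insert 0 (set (take r (map fst w))) \<Longrightarrow> generic (shift z (drop r w))"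
    and "distinct (0 # take r (map fst w))"
proof -
  have R: "generic (take r w @ drop r w)"
    using assms by simp
  then show "z \<in> insert 0 (set (take r (map fst w))) \<Longrightarrow> generic (shift z (drop r w))"
    unfolding generic_append take_map by (intro generic_shift) (auto simp: generic_def)
  show "distinct (0 # take r (map fst w))"
    using generic_take[OF assms, of r] by (auto simp: generic_def take_map)
  assume r: "r < length w" "1 \<le> r"
  let ?x = "take (r - 1) w" and ?y = "take (length w - r) (drop (r - 1) w)"
  have "w = ?x @ ?y @ [last w]"
  proof (cases w rule: rev_cases)
    case (snoc v a)
    have "take (length v - (r - 1)) (drop (r - 1) v) = drop (r - 1) v"
      by simp
    then show ?thesis
      using r by (simp add: snoc Suc_diff_le)
  qed (use r in simp)
  then have "generic (?x @ ?y @ [last w])"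
    using assms by simp
  then have xy: "generic ?x" "generic ?y" "fst ` set ?x \<inter> fst ` set ?y = {}"
    "fst (last w) \<notin> fst ` set ?x \<union> fst ` set ?y" "fst (last w) \<noteq> 0"
    by (auto simp: generic_append generic_Cons)
  show "generic (shift z ?y)"
    if "z \<in> insert 0 (insert (fst (last w)) (set (take (r - 1) (map fst w))))"
  proof (rule generic_shift[OF xy(2)])
    have "z = 0 \<or> z = fst (last w) \<or> z \<in> fst ` set ?x"
      using that by (simp add: take_map)
    then show "z \<notin> fst ` set ?y"
      using xy(2-4) by (elim disjE) (simp_all add: generic_def disjoint_iff)
  qed
  show "distinct (0 # take (r - 1) (map fst w) @ [fst (last w)])"
    using xy unfolding take_map by (simp add: generic_def)
qed

lemma natural_C_word:
  assumes B: "natural B"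
  shows "natural (C_word B)"
  unfolding natural_def
proof (intro allI impI)
  fix \<sigma> w w' assume *: "list_all2 (specializes_letter \<sigma>) w w'" "generic w'"
  have len: "length w = length w'"
    using *(1) by (rule list_all2_lengthD)
  show "specializes \<sigma> (C_word B w) (C_word B w')"
    unfolding C_word_def len
  proof (intro specializes_sum specializes_diff)
    fix r assume r: "r \<in> {1..<length w'}"
    have "specializes \<sigma> (div_diff (\<lambda>t. B (shift t (take (length w' - r) (drop (r - 1) w))))
          (set (0 # take (r - 1) (map fst w) @ [fst (last w)])))
        (div_diff (\<lambda>t. B (shift t (take (length w' - r) (drop (r - 1) w'))))
          (set (0 # take (r - 1) (map fst w') @ [fst (last w')])))"
    proof (rule specializes_div_diff)
      show "list_all2 (specializes \<sigma>) (0 # take (r - 1) (map fst w) @ [fst (last w)])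
          (0 # take (r - 1) (map fst w') @ [fst (last w')])"
      proof -
        have "w' \<noteq> []"
          using r by auto
        then show ?thesis
          using specializes_letter_last[OF *(1)] specializes_map_fst[OF *(1)]
          by (intro list_all2_appendI list_all2_takeI list.rel_intros specializes_0)
              (simp_all add: specializes_letter_def)
      qed
      show "distinct (0 # take (r - 1) (map fst w') @ [fst (last w')])"
        using r generic_nodes(2)[OF *(2), of r] by simp
      show "specializes \<sigma> (B (shift z (take (length w' - r) (drop (r - 1) w))))
          (B (shift z' (take (length w' - r) (drop (r - 1) w'))))"
        if "specializes \<sigma> z z'" "z' \<in> set (0 # take (r - 1) (map fst w') @ [fst (last w')])" for z
            z'
        using that * r
        by (intro naturalD[OF B] specializes_letter_shift list_all2_takeI list_all2_dropI
            generic_nodes(1)) auto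
    qed
    then show "specializes \<sigma> (div_diff (\<lambda>t. B (shift t (take (length w' - r) (drop (r - 1) w))))
          (insert 0 (insert (fst (last w)) (set (take (r - 1) (map fst w))))))
        (div_diff (\<lambda>t. B (shift t (take (length w' - r) (drop (r - 1) w'))))
          (insert 0 (insert (fst (last w')) (set (take (r - 1) (map fst w'))))))"
      by simp
    have "specializes \<sigma> (div_diff (\<lambda>t. B (shift t (drop r w))) (set (0 # take r (map fst w))))
        (div_diff (\<lambda>t. B (shift t (drop r w'))) (set (0 # take r (map fst w'))))"
    proof (rule specializes_div_diff)
      show "list_all2 (specializes \<sigma>) (0 # take r (map fst w)) (0 # take r (map fst w'))"
        using * by (auto intro!: list_all2_takeI specializes_map_fst)
      show "distinct (0 # take r (map fst w'))"
        by (rule generic_nodes(4)[OF *(2)])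
      show "specializes \<sigma> (B (shift z (drop r w))) (B (shift z' (drop r w')))"
        if "specializes \<sigma> z z'" "z' \<in> set (0 # take r (map fst w'))" for z z'
        using that * by (intro naturalD[OF B] specializes_letter_shift list_all2_dropI
            generic_nodes(3)) auto
    qed
    then show "specializes \<sigma> (div_diff (\<lambda>t. B (shift t (drop r w)))
        (insert 0 (set (take r (map fst w)))))
        (div_diff (\<lambda>t. B (shift t (drop r w'))) (insert 0 (set (take r (map fst w')))))"
      by simp
  qed
qed

section \<open>Bimoulds as functions on words\<close>

definition word_fun :: "bimould \<Rightarrow> ratfun word \<Rightarrow> ratfun" where
  "word_fun A w = ev A (length w) (map fst w) (map snd w)"

text \<open>Definedness at all generic words, which is what the operators use of the elements of \<open>\<L>\<^sub>r\<close>.\<close>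

definition regular :: "bimould \<Rightarrow> bool" where
  "regular A \<longleftrightarrow> (\<forall>w. generic w \<longrightarrow>
     specializes (list_subst (map fst w) (map snd w)) (A (length w)) (word_fun A w))"

definition letters :: "nat \<Rightarrow> nat \<Rightarrow> ratfun word" where
  "letters a b = map (\<lambda>i. (Xv i, Yv i)) [a..<Suc b]"

lemma ev_eq_word_fun: "length w = r \<Longrightarrow> map fst w = xs \<Longrightarrow> map snd w = ys \<Longrightarrow> ev A r xs ys = word_fun A w"
  by (auto simp: word_fun_def)

lemma natural_word_fun:
  assumes "regular A"
  shows "natural (word_fun A)"
  unfolding natural_def
proof (intro allI impI)
  fix \<sigma> w w' assume *: "list_all2 (specializes_letter \<sigma>) w w'" "generic w'"
  have len: "length w = length w'"
    using *(1) by (rule list_all2_lengthD)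
  have "specializes \<sigma> (list_subst (map fst w) (map snd w) v)
      (list_subst (map fst w') (map snd w') v)" for v
    using specializes_letter_nth[OF *(1)] by (cases v)
        (auto simp: list_subst_def len specializes_letter_def)
  then show "specializes \<sigma> (word_fun A w) (word_fun A w')"
    using assms *(2) unfolding regular_def word_fun_def[of A w] ev_def len by
        (blast intro: specializes_rsubst)
qed

lemma specializes_letter_letters:
  "list_all2 (specializes_letter (list_subst (map fst w) (map snd w))) (letters 1 (length w)) w"
proof (rule list_all2_all_nthI)
  let ?\<sigma> = "list_subst (map fst w) (map snd w)"
  show "length (letters 1 (length w)) = length w"
    by (simp add: letters_def del: upt_Suc)
  fix i assume "i < length (letters 1 (length w))"
  then have "letters 1 (length w) ! i = (Xv (Suc i), Yv (Suc i))"
    "?\<sigma> (VX (Suc i)) = fst (w ! i)" "?\<sigma> (VY (Suc i)) = snd (w ! i)"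
    by (simp_all add: letters_def list_subst_def del: upt_Suc)
  then show "specializes_letter ?\<sigma> (letters 1 (length w) ! i) (w ! i)"
    using specializes_var[of ?\<sigma> "VX (Suc i)"] specializes_var[of ?\<sigma> "VY (Suc i)"] by
        (simp add: specializes_letter_def)
qed

text \<open>The bridge from bimoulds to words. A component given by evaluating a natural function at the
  generic word \<open>(X\<^sub>1, Y\<^sub>1), \<dots>, (X\<^sub>r, Y\<^sub>r)\<close> determines that function at all generic words, since
  they are specialisations of this one. Each flexion operation is therefore only computed at the
  word of variables.\<close>

lemma regularI:
  assumes E: "\<And>r. E r = F (letters 1 r)" and F: "natural F"
  shows "regular E" and "generic w \<Longrightarrow> word_fun E w = F w"
proof -
  have *: "specializes (list_subst (map fst w) (map snd w)) (E (length w)) (F w)" if "generic w"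
      for w
    unfolding E using F specializes_letter_letters that by (rule naturalD)
  show word_fun: "word_fun E w = F w" if "generic w" for w
    using rsubst_specializes[OF *[OF that]] by (simp add: word_fun_def ev_def)
  show "regular E"
    using * by (simp add: regular_def word_fun)
qed

text \<open>Variables are distinguished by substitutions with values \<open>0\<close> and \<open>1\<close>.\<close>

lemma generic_letters: "1 \<le> a \<Longrightarrow> generic (letters a b)"
proof -
  have "Xv i \<noteq> 0" for i
  proof
    assume "Xv i = 0"
    then show False
      using specializes_unique[OF specializes_0, of "\<lambda>_. 1" 1] specializes_var[of "\<lambda>_. 1" "VX i"]
          by simp
  qed
  moreover have "i = j" if "Xv i = Xv j" for i j
  proof -
    define \<sigma> :: "var \<Rightarrow> ratfun" where "\<sigma> v = (if v = VX i then 0 else 1)" for v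
    have "\<sigma> (VX i) = \<sigma> (VX j)"
      using specializes_var[of \<sigma> "VX i"] specializes_var[of \<sigma> "VX j"] unfolding that by
          (rule specializes_unique)
    then show ?thesis
      by (simp add: \<sigma>_def split: if_splits)
  qed
  ultimately show ?thesis
    by (auto simp: generic_def letters_def distinct_map inj_on_def comp_def simp del: upt_Suc)
qed

lemma letters_simps [simp]:
  "length (letters a b) = Suc b - a" "map fst (letters a b) = Xs a b"
      "map snd (letters a b) = Ys a b"
  "0 < a \<Longrightarrow> a + n \<le> Suc b \<Longrightarrow> take n (letters a b) = letters a (a + n - 1)"
  "drop n (letters a b) = letters (a + n) b"
  "map fst (shift t (letters a b)) = Xsd a b t"
proof -
  show "take n (letters a b) = letters a (a + n - 1)" if "0 < a" "a + n \<le> Suc b"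
    using that by (cases "a + n") (auto simp: letters_def take_map simp del: upt_Suc)
qed (auto simp: letters_def Xs_def Ys_def Xsd_def drop_map comp_def simp del: upt_Suc)

lemma letters_Cons: "a \<le> b \<Longrightarrow> letters a b = (Xv a, Yv a) # letters (Suc a) b"
  by (simp add: letters_def upt_conv_Cons del: upt_Suc)

lemma letters_snoc: "a \<le> Suc b \<Longrightarrow> letters a (Suc b) = letters a b @ [(Xv (Suc b), Yv (Suc b))]"
  by (simp add: letters_def)

lemma sum_list_Ys: "sum_list (Ys a b) = Ysum a b"
  by (simp add: Ys_def Ysum_def interv_sum_list_conv_sum_set_nat atLeastLessThanSuc_atLeastAtMost
      del: upt_Suc)

lemma mergeF_letters: "a \<le> b \<Longrightarrow> mergeF (letters a b) = (Xv a, Ysum a b)"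
  by (simp add: mergeF_def sum_list_Ys) (simp add: letters_Cons)

lemma mergeL_letters: "a \<le> b \<Longrightarrow> mergeL (letters a b) = (Xv b, Ysum a b)"
  by (cases b) (simp_all add: mergeL_def sum_list_Ys, simp_all add: letters_snoc letters_def)

lemma Xs_Cons: "a \<le> b \<Longrightarrow> Xs a b = Xv a # Xs (Suc a) b"
  by (simp add: Xs_def upt_conv_Cons del: upt_Suc)

lemma Xs_snoc: "a \<le> Suc b \<Longrightarrow> Xs a (Suc b) = Xs a b @ [Xv (Suc b)]"
  by (simp add: Xs_def)

lemma pic_letters: "pic r = pic_word (letters 1 r)"
  by (simp add: pic_def pic_word_def Xs_def prod_list_upt atLeastLessThanSuc_atLeastAtMost del:
      upt_Suc)

lemma poc_letters: "poc r = poc_word (letters 1 r)"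
proof (cases r)
  case (Suc n)
  have "chain (letters a (a + k)) = 1 / (\<Prod>i=a..<a + k. Xv i - Xv (Suc i))" for a k
  proof (induction k arbitrary: a)
    case 0
    then show ?case
      by (simp add: letters_def)
  next
    case (Suc k)
    have "letters a (a + Suc k) = (Xv a, Yv a) # (Xv (Suc a), Yv (Suc a)) # letters (Suc (Suc a))
        (Suc a + k)"
      "letters (Suc a) (Suc a + k) = (Xv (Suc a), Yv (Suc a)) # letters (Suc (Suc a)) (Suc a + k)"
      by (simp_all add: letters_Cons)
    then show ?case
      using Suc.IH[of "Suc a"] by (simp add: prod.atLeast_Suc_lessThan[of a "Suc (a + k)"]
          del: prod.op_ivl_Suc)
  qed
  from this[of 1 n] show ?thesis
    by (simp add: Suc poc_def letters_Cons[of "Suc 0"])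
qed (simp add: poc_def letters_def)

lemma mu_letters: "mu A B r = deconc (\<lambda>u v. word_fun A u * word_fun B v) (letters 1 r)"
  unfolding mu_def deconc_def
  by (intro sum.cong arg_cong2[of _ _ _ _ "(*)"] ev_eq_word_fun) auto

lemma pairs_sum:
  "(\<Sum>(a, b) \<in> {(a, b). 1 \<le> a \<and> a < b \<and> b \<le> r}. F a b) = (\<Sum>j<r. \<Sum>i<j. F (Suc i) (Suc j))"
  for r :: nat
  unfolding sum.Sigma[OF finite_lessThan ballI[OF finite_lessThan]]
  by (rule sum.reindex_bij_witness[of _ "\<lambda>(j, i). (Suc i, Suc j)" "\<lambda>(a, b). (b - 1, a - 1)"]) auto

lemma block_der_letters:
  "block_der d A (letters 1 r) = (\<Sum>j<r. \<Sum>i\<le>j. d (letters (Suc i) (Suc j))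
     (\<lambda>l. A (letters 1 i @ l # letters (Suc (Suc j)) r)))"
proof -
  have "take i (letters 1 r) = letters 1 i"
    "take (Suc j - i) (drop i (letters 1 r)) = letters (Suc i) (Suc j)"
    "drop (Suc j) (letters 1 r) = letters (Suc (Suc j)) r" if "i \<le> j" "j < r" for i j
    using that by simp_all
  then show ?thesis
    unfolding block_der_sum by (intro sum.cong) (simp_all del: letters_simps(4,5) One_nat_def)
qed

lemma word_fun_Nil: "A 0 = 0 \<Longrightarrow> word_fun A [] = 0"
  by (simp add: word_fun_def ev_def rsubst_specializes)

lemma amit_letters:
  assumes "B 0 = 0"
  shows "amit B A r = block_der (amit_ker (word_fun B)) (word_fun A) (letters 1 r)"
proof -
  \<comment> \<open>The flexion operator has no terms with \<open>a = b\<close>; in the derivation they vanish.\<close>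
  have "amit_ker (word_fun B) (letters (Suc j) (Suc j)) f = 0" for j f
    using word_fun_Nil[of B, OF assms] by (simp add: amit_ker_def letters_def)
  then have "block_der (amit_ker (word_fun B)) (word_fun A) (letters 1 r) =
      (\<Sum>j<r. \<Sum>i<j. amit_ker (word_fun B) (letters (Suc i) (Suc j))
      (\<lambda>l. word_fun A (letters 1 i @ l # letters (Suc (Suc j)) r)))"
    unfolding block_der_letters by (simp flip: lessThan_Suc_atMost)
  also have "\<dots> = amit B A r"
    unfolding amit_def pairs_sum
  proof (intro sum.cong refl)
    fix i j assume *: "j \<in> {..<r}" "i \<in> {..<j}"
    have "amit_ker (word_fun B) (letters (Suc i) (Suc j))
        (\<lambda>l. word_fun A (letters 1 i @ l # letters (Suc (Suc j)) r)) =
        word_fun A (letters 1 i @ (Xv (Suc j), Ysum (Suc i) (Suc j)) # letters (Suc (Suc j)) r) *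
        word_fun B (shift (Xv (Suc j)) (letters (Suc i) j))"
      using * by (simp add: amit_ker_def mergeL_letters mult.commute) (simp add: letters_snoc)
    also have "\<dots> = ev A (r - Suc j + Suc i) (Xs 1 (Suc i - 1) @ Xs (Suc j) r)
        (Ys 1 (Suc i - 1) @ [Ysum (Suc i) (Suc j)] @ Ys (Suc j + 1) r) *
      ev B (Suc j - Suc i) (Xsd (Suc i) (Suc j - 1) (Xv (Suc j))) (Ys (Suc i) (Suc j - 1))"
      using * by (intro arg_cong2[of _ _ _ _ "(*)"]; intro ev_eq_word_fun[symmetric])
        (auto simp: Xs_Cons Xsd_def)
    finally show "amit_ker (word_fun B) (letters (Suc i) (Suc j))
        (\<lambda>l. word_fun A (letters 1 i @ l # letters (Suc (Suc j)) r)) = \<dots>" .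
  qed
  finally show ?thesis ..
qed

lemma anit_letters:
  assumes "B 0 = 0"
  shows "anit B A r = block_der (anit_ker (word_fun B)) (word_fun A) (letters 1 r)"
proof -
  have "anit_ker (word_fun B) (letters (Suc j) (Suc j)) f = 0" for j f
    using word_fun_Nil[of B, OF assms] by (simp add: anit_ker_def letters_def)
  then have "block_der (anit_ker (word_fun B)) (word_fun A) (letters 1 r) =
      (\<Sum>j<r. \<Sum>i<j. anit_ker (word_fun B) (letters (Suc i) (Suc j))
      (\<lambda>l. word_fun A (letters 1 i @ l # letters (Suc (Suc j)) r)))"
    unfolding block_der_letters by (simp flip: lessThan_Suc_atMost)
  also have "\<dots> = anit B A r"
    unfolding anit_def pairs_sum
  proof (intro sum.cong refl)
    fix i j assume *: "j \<in> {..<r}" "i \<in> {..<j}"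
    have "anit_ker (word_fun B) (letters (Suc i) (Suc j))
        (\<lambda>l. word_fun A (letters 1 i @ l # letters (Suc (Suc j)) r)) =
        word_fun A (letters 1 i @ (Xv (Suc i), Ysum (Suc i) (Suc j)) # letters (Suc (Suc j)) r) *
        word_fun B (shift (Xv (Suc i)) (letters (Suc (Suc i)) (Suc j)))"
      using * by (simp add: anit_ker_def mergeF_letters mult.commute) (simp add: letters_Cons)
    also have "\<dots> = ev A (r - Suc j + Suc i) (Xs 1 (Suc i) @ Xs (Suc j + 1) r)
        (Ys 1 (Suc i - 1) @ [Ysum (Suc i) (Suc j)] @ Ys (Suc j + 1) r) *
      ev B (Suc j - Suc i) (Xsd (Suc i + 1) (Suc j) (Xv (Suc i))) (Ys (Suc i + 1) (Suc j))"
      using * by (intro arg_cong2[of _ _ _ _ "(*)"]; intro ev_eq_word_fun[symmetric])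
        (auto simp: Xs_snoc Xsd_def)
    finally show "anit_ker (word_fun B) (letters (Suc i) (Suc j))
        (\<lambda>l. word_fun A (letters 1 i @ l # letters (Suc (Suc j)) r)) = \<dots>" .
  qed
  finally show ?thesis ..
qed

text \<open>The \<open>i\<close>-th block, counted from \<open>0\<close>, of the factorisation with cuts \<open>q\<close>.\<close>

definition block :: "nat list \<Rightarrow> nat \<Rightarrow> 'l list \<Rightarrow> 'l list" where
  "block q i w = take (q ! Suc i - q ! i) (drop (q ! i) w)"

lemma cuts_nth:
  assumes "q \<in> cuts s r" "i < s"
  shows "q ! i < q ! Suc i" and "q ! Suc i \<le> r"
proof -
  have sorted: "q ! k < q ! l" if "k < l" "l \<le> s" for k l
    using assms(1) that by (auto simp: cuts_def sorted_wrt_iff_nth_less)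
  show "q ! i < q ! Suc i"
    using sorted assms(2) by simp
  show "q ! Suc i \<le> r"
    using sorted[of "Suc i" s] assms by (cases "Suc i = s") (auto simp: cuts_def)
qed

lemma cuts_ge: "q \<in> cuts s r \<Longrightarrow> i \<le> s \<Longrightarrow> i \<le> q ! i"
proof (induction i)
  case (Suc i)
  then show ?case
    using cuts_nth(1)[of q s r i] by simp
qed simp

lemma cuts_empty: "r < s \<Longrightarrow> cuts s r = {}"
proof (rule equals0I)
  fix q assume "r < s" "q \<in> cuts s r"
  then show False
    using cuts_ge[of q s r s] by (simp add: cuts_def)
qed

lemma cuts_0: "cuts 0 r = (if r = 0 then {[0]} else {})"
  by (auto simp: cuts_def length_Suc_conv)

lemma finite_cuts: "finite (cuts s r)"
proof (rule finite_subset)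
  show "cuts s r \<subseteq> {q. set q \<subseteq> {..r} \<and> length q = s + 1}"
  proof safe
    fix q x assume q: "q \<in> cuts s r" "x \<in> set q"
    then obtain i where "x = q ! i" "i \<le> s"
      by (auto simp: cuts_def in_set_conv_nth)
    then show "x \<le> r"
      using q cuts_nth(2)[OF q(1), of "i - 1"] by (cases i) (auto simp: cuts_def)
  qed (simp add: cuts_def)
qed (simp add: finite_lists_length_eq)

text \<open>Splitting off the first block, of length \<open>Suc k\<close>.\<close>

lemma sum_cuts_Suc:
  "(\<Sum>q\<in>cuts (Suc s) (Suc n). F q) =
    (\<Sum>k\<le>n. \<Sum>q\<in>cuts s (n - k). F (0 # map (\<lambda>x. x + Suc k) q))"
  unfolding sum.Sigma[OF finite_atMost ballI[OF finite_cuts]]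
proof (rule sum.reindex_bij_witness[of _ "\<lambda>(k, q). 0 # map (\<lambda>x. x + Suc k) q"
      "\<lambda>q. (q ! 1 - 1, map (\<lambda>x. x - q ! 1) (tl q))"], goal_cases)
  case (1 q)
  then obtain b q' where q: "q = 0 # b # q'" "0 < b" "\<forall>x\<in>set q'. b < x"
    by (auto simp: cuts_def length_Suc_conv)
  then have "map (\<lambda>x. x - b + b) q' = q'"
    by (intro map_idI) auto
  with q show ?case
    by (simp add: comp_def)
next
  case (2 q)
  then obtain b q' where q: "q = 0 # b # q'" "0 < b" "\<forall>x\<in>set q'. b < x" "length q' = s"
    "(b # q') ! s = Suc n" "sorted_wrt (<) q'"
    by (auto simp: cuts_def length_Suc_conv)
  then have "(b # q') ! s \<in> set (b # q')"
    by (intro nth_mem) simp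
  then have "b \<le> Suc n"
    using q by auto
  moreover have "sorted_wrt (\<lambda>x y. x - b < y - b) q'"
    using q(3) by (intro sorted_wrt_mono_rel[OF _ q(6)]) (auto intro: diff_less_mono)
  moreover have "map (\<lambda>x. x - b) (b # q') ! s = n - (b - 1)"
    using q by (subst nth_map) auto
  ultimately show ?case
    using q by (auto simp: cuts_def sorted_wrt_map)
next
  case (3 b)
  then show ?case
    by (auto simp: cuts_def comp_def)
next
  case (4 b)
  then show ?case
    by (auto simp: cuts_def sorted_wrt_map intro: sorted_wrt_mono_rel[rotated])
next
  case (5 q)
  then obtain b q' where q: "q = 0 # b # q'" "0 < b" "\<forall>x\<in>set q'. b < x"
    by (auto simp: cuts_def length_Suc_conv)
  then have "map (\<lambda>x. x - b + b) q' = q'"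
    by (intro map_idI) auto
  with q show ?case
    by (simp add: comp_def)
qed

text \<open>The closed form of the recursion, as in the definition of \<^const>\<open>ganit\<close>.\<close>

lemma block_aut_cuts:
  fixes A :: "'l list \<Rightarrow> 'k::comm_ring_1"
  shows "block_aut c h A w = (\<Sum>s\<le>length w. \<Sum>q\<in>cuts s (length w).
     A (map (\<lambda>i. h (block q i w)) [0..<s]) * (\<Prod>i<s. c (block q i w)))"
proof (induction A w rule: block_aut_induct)
  case (Nil A)
  then show ?case by (simp add: cuts_0)
next
  case (Cons A a w)
  define T where "T A w s q = A (map (\<lambda>i. h (block q i w)) [0..<s]) * (\<Prod>i<s. c (block q i w))"
    for A s q and w :: "'l list"
  have step: "T A (a # w) (Suc s) (0 # map (\<lambda>x. x + Suc k) q) =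
      c (a # take k w) * T (\<lambda>x. A (h (a # take k w) # x)) (drop k w) s q"
    if q: "q \<in> cuts s (length w - k)" for k s q
  proof -
    let ?q = "0 # map (\<lambda>x. x + Suc k) q"
    have len: "length q = Suc s" "q ! 0 = 0"
      using q by (simp_all add: cuts_def)
    then have "block ?q 0 (a # w) = a # take k w"
      by (simp add: block_def)
    moreover have "block ?q (Suc i) (a # w) = block q i (drop k w)" if "i < s" for i
      using that len by (simp add: block_def add.commute)
    ultimately have "map (\<lambda>i. h (block ?q i (a # w))) [0..<Suc s] =
        h (a # take k w) # map (\<lambda>i. h (block q i (drop k w))) [0..<s]"
      "(\<Prod>i<Suc s. c (block ?q i (a # w))) = c (a # take k w) * (\<Prod>i<s. c (block q i (drop k w)))"
      by (simp_all add: map_upt_Suc prod.lessThan_Suc_shift del: upt_Suc prod.lessThan_Suc)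
    then show ?thesis
      unfolding T_def by (simp only: ac_simps)
  qed
  have "(\<Sum>s\<le>length (a # w). \<Sum>q\<in>cuts s (length (a # w)). T A (a # w) s q) =
      (\<Sum>s\<le>length w. \<Sum>k\<le>length w. \<Sum>q\<in>cuts s (length w - k).
        T A (a # w) (Suc s) (0 # map (\<lambda>x. x + Suc k) q))"
    by (simp add: sum.atMost_Suc_shift cuts_0 sum_cuts_Suc del: sum.atMost_Suc)
  also have "\<dots> = (\<Sum>k\<le>length w. \<Sum>s\<le>length w. \<Sum>q\<in>cuts s (length w - k).
        c (a # take k w) * T (\<lambda>x. A (h (a # take k w) # x)) (drop k w) s q)"
    by (subst sum.swap) (intro sum.cong refl step)
  also have "\<dots> = (\<Sum>k\<le>length w. c (a # take k w) * (\<Sum>s\<le>length w - k. \<Sum>q\<in>cuts s (length w - k).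
        T (\<lambda>x. A (h (a # take k w) # x)) (drop k w) s q))"
    unfolding sum_distrib_left
    by (intro sum.cong[OF refl] sum.mono_neutral_right) (auto simp: cuts_empty)
  also have "\<dots> = block_aut c h A (a # w)"
    unfolding block_aut.simps(2)
  proof (intro sum.cong refl arg_cong2[of _ _ _ _ "(*)"])
    fix k
    show "(\<Sum>s\<le>length w - k. \<Sum>q\<in>cuts s (length w - k).
        T (\<lambda>x. A (h (a # take k w) # x)) (drop k w) s q) =
        block_aut c h (\<lambda>x. A (h (a # take k w) # x)) (drop k w)"
      using Cons.IH[of "take k w" "drop k w"] by (simp add: T_def)
  qed
  finally show ?case
    by (simp only: T_def)
qed

lemma ganit_letters:
  assumes "A 0 = 0"
  shows "ganit C A r = ganit_word (word_fun C) (word_fun A) (letters 1 r)"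
proof (cases "r = 0")
  case True
  then show ?thesis
    using word_fun_Nil[of A, OF assms] assms by (simp add: ganit_def letters_def)
next
  case False
  have summand: "word_fun A (map (\<lambda>i. mergeF (block q i (letters 1 r))) [0..<s]) *
      (\<Prod>i<s. word_fun C (shift (fst (hd (block q i (letters 1 r))))
          (tl (block q i (letters 1 r))))) =
    ev A s (map (\<lambda>i. Xv (q ! (i - 1) + 1)) [1..<Suc s])
       (map (\<lambda>i. Ysum (q ! (i - 1) + 1) (q ! i)) [1..<Suc s]) *
    (\<Prod>i=1..s. ev C (q ! i - q ! (i - 1) - 1)
       (Xsd (q ! (i - 1) + 2) (q ! i) (Xv (q ! (i - 1) + 1)))
       (Ys (q ! (i - 1) + 2) (q ! i)))" if q: "q \<in> cuts s r" for s q
  proof (rule arg_cong2[of _ _ _ _ "(*)"])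
    have block: "block q i (letters 1 r) = letters (Suc (q ! i)) (q ! Suc i)" if "i < s" for i
      using cuts_nth[OF q that] by (simp add: block_def)
    have prod_from_1: "prod F {1..s} = (\<Prod>i<s. F (Suc i))" for F :: "nat \<Rightarrow> ratfun"
      by (simp add: prod.atLeast1_atMost_eq)
    have upt: "[1..<Suc s] = map Suc [0..<s]"
      by (simp add: map_Suc_upt del: upt_Suc)
    show "word_fun A (map (\<lambda>i. mergeF (block q i (letters 1 r))) [0..<s]) =
        ev A s (map (\<lambda>i. Xv (q ! (i - 1) + 1)) [1..<Suc s])
         (map (\<lambda>i. Ysum (q ! (i - 1) + 1) (q ! i)) [1..<Suc s])"
      unfolding upt using cuts_nth(1)[OF q]
      by (intro ev_eq_word_fun[symmetric]) (simp_all add: block[simplified] mergeF_letters Suc_leI)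
    show "(\<Prod>i<s. word_fun C (shift (fst (hd (block q i (letters 1 r))))
        (tl (block q i (letters 1 r))))) =
      (\<Prod>i=1..s. ev C (q ! i - q ! (i - 1) - 1)
       (Xsd (q ! (i - 1) + 2) (q ! i) (Xv (q ! (i - 1) + 1)))
       (Ys (q ! (i - 1) + 2) (q ! i)))"
      unfolding prod_from_1
    proof (intro prod.cong refl ev_eq_word_fun[symmetric])
      fix i assume "i \<in> {..<s}"
      then have "i < s" "q ! i < q ! Suc i"
        using cuts_nth(1)[OF q] by auto
      then have "shift (fst (hd (block q i (letters 1 r)))) (tl (block q i (letters 1 r))) =
          shift (Xv (q ! i + 1)) (letters (q ! i + 2) (q ! Suc i))"
        by (simp add: block[simplified] letters_Cons)
      then show "length (shift (fst (hd (block q i (letters 1 r))))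
          (tl (block q i (letters 1 r)))) =
          q ! Suc i - q ! (Suc i - 1) - 1"
        "map fst (shift (fst (hd (block q i (letters 1 r)))) (tl (block q i (letters 1 r)))) =
          Xsd (q ! (Suc i - 1) + 2) (q ! Suc i) (Xv (q ! (Suc i - 1) + 1))"
        "map snd (shift (fst (hd (block q i (letters 1 r)))) (tl (block q i (letters 1 r)))) =
          Ys (q ! (Suc i - 1) + 2) (q ! Suc i)"
        by (simp_all del: shift_simps(5))
    qed
  qed
  have "length (letters 1 r) = r"
    by simp
  then have "ganit_word (word_fun C) (word_fun A) (letters 1 r) = (\<Sum>s=1..r. \<Sum>q\<in>cuts s r.
      word_fun A (map (\<lambda>i. mergeF (block q i (letters 1 r))) [0..<s]) *
      (\<Prod>i<s. word_fun C (shift (fst (hd (block q i (letters 1 r))))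
          (tl (block q i (letters 1 r))))))"
    unfolding ganit_word_def block_aut_cuts using False
    by (simp only:) (rule sum.mono_neutral_right; auto simp: cuts_0 not_less_eq_eq)
  also have "\<dots> = ganit C A r"
    unfolding ganit_def if_not_P[OF False] by (intro sum.cong refl summand)
  finally show ?thesis ..
qed

lemma Cmould_letters: "Cmould B m = C_word (word_fun B) (letters 1 m)"
proof (cases "m < 2")
  case False
  let ?w = "letters 1 m"
  have gen: "generic ?w" and len: "length ?w = m"
    by (simp_all add: generic_letters)
  have last: "fst (last ?w) = Xv m"
    using False by (simp add: letters_def)
  have "Lterm B m r - Rterm B m r =
      div_diff (\<lambda>t. word_fun B (shift t (take (m - r) (drop (r - 1) ?w))))
        (insert 0 (insert (fst (last ?w)) (set (take (r - 1) (map fst ?w))))) -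
      div_diff (\<lambda>t. word_fun B (shift t (drop r ?w))) (insert 0 (set (take r (map fst ?w))))"
    if r: "1 \<le> r" "r < m" for r
  proof (rule arg_cong2[of _ _ _ _ "(-)"])
    have take_Xs: "take n (Xs 1 m) = Xs 1 n" if "n \<le> m" for n
      using that by (simp add: Xs_def take_map del: upt_Suc)
    have "distinct (0 # Xs 1 (r - 1) @ [Xv m])"
      using generic_nodes(2)[OF gen, of r] r take_Xs[of "r - 1"] by
          (simp only: len last letters_simps)
    moreover have "ev B (m - r) (Xsd r (m - 1) t) (Ys r (m - 1)) =
        word_fun B (shift t (take (m - r) (drop (r - 1) ?w)))" for t
      using r by (intro ev_eq_word_fun) (simp_all del: shift_simps(5))
    ultimately show "Lterm B m r =
        div_diff (\<lambda>t. word_fun B (shift t (take (m - r) (drop (r - 1) ?w))))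
        (insert 0 (insert (fst (last ?w)) (set (take (r - 1) (map fst ?w)))))"
      using r take_Xs[of "r - 1"] unfolding Lterm_def last by
          (simp only: divD_eq_div_diff letters_simps) simp
    have "distinct (0 # Xs 1 r)"
      using generic_nodes(4)[OF gen, of r] r take_Xs[of r] by (simp only: letters_simps)
    moreover have "ev B (m - r) (Xsd (r + 1) m t) (Ys (r + 1) m) =
        word_fun B (shift t (drop r ?w))" for t
      using r by (intro ev_eq_word_fun) (simp_all del: shift_simps(5))
    ultimately show "Rterm B m r = div_diff (\<lambda>t. word_fun B (shift t (drop r ?w)))
        (insert 0 (set (take r (map fst ?w))))"
      using r take_Xs[of r] unfolding Rterm_def by (simp only: divD_eq_div_diff letters_simps) simp
  qed
  moreover have "{1..m - 1} = {1..<m}"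
    using False by auto
  ultimately show ?thesis
    using False unfolding Cmould_def C_word_def len by simp
qed (auto simp: Cmould_def C_word_def)

lemma block_der_amit_ker_cong:
  assumes "generic w" and A: "\<And>v. generic v \<Longrightarrow> A v = A' v" and B: "\<And>v. generic v \<Longrightarrow> B v = B' v"
  shows "block_der (amit_ker B) A w = block_der (amit_ker B') A' w"
  unfolding block_der_sum
proof (intro sum.cong refl)
  fix i j assume "j \<in> {..<length w}" "i \<in> {..j}"
  then have ij: "i \<le> j" "j < length w"
    by auto
  have "generic (take i w @ mergeL (take (Suc j - i) (drop i w)) # drop (Suc j) w)"
    using factor_split[OF ij] assms(1) by (intro generic_mergeL) auto
  then show "amit_ker B (take (Suc j - i) (drop i w)) (\<lambda>l. A (take i w @ l # drop (Suc j) w)) =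
      amit_ker B' (take (Suc j - i) (drop i w)) (\<lambda>l. A' (take i w @ l # drop (Suc j) w))"
    unfolding amit_ker_def using assms(1)
    by (simp only: A B generic_shift_butlast generic_take generic_drop)
qed

lemma block_der_anit_ker_cong:
  assumes "generic w" and A: "\<And>v. generic v \<Longrightarrow> A v = A' v" and B: "\<And>v. generic v \<Longrightarrow> B v = B' v"
  shows "block_der (anit_ker B) A w = block_der (anit_ker B') A' w"
  unfolding block_der_sum
proof (intro sum.cong refl)
  fix i j assume "j \<in> {..<length w}" "i \<in> {..j}"
  then have ij: "i \<le> j" "j < length w"
    by auto
  have "generic (take i w @ mergeF (take (Suc j - i) (drop i w)) # drop (Suc j) w)"
    using factor_split[OF ij] assms(1) by (intro generic_mergeF) auto
  then show "anit_ker B (take (Suc j - i) (drop i w)) (\<lambda>l. A (take i w @ l # drop (Suc j) w)) =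
      anit_ker B' (take (Suc j - i) (drop i w)) (\<lambda>l. A' (take i w @ l # drop (Suc j) w))"
    unfolding anit_ker_def using assms(1)
    by (simp only: A B generic_shift_tl generic_take generic_drop)
qed

lemma ganit_word_cong:
  assumes "generic w" and A: "\<And>v. generic v \<Longrightarrow> A v = A' v" and C: "\<And>v. generic v \<Longrightarrow> C v = C' v"
  shows "ganit_word C A w = ganit_word C' A' w"
proof -
  have "ganit_word C A w = ganit_word C A' w"
    unfolding ganit_word_def
    by (rule block_aut_cong, rule A, rule generic_map_mergeF) (use assms(1) in simp_all)
  also have "\<dots> = ganit_word C' A' w"
    using assms(1)
  proof (induction A' w rule: block_aut_induct)
    case (Cons A a w)
    show ?case
      unfolding ganit_word_Cons
    proof (intro deconc_cong arg_cong2[of _ _ _ _ "(*)"] Cons.IH)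
      fix u v assume uv: "u @ v = w"
      then show "generic v"
        using Cons.prems by (auto simp: generic_Cons generic_append)
      show "C (shift (fst a) u) = C' (shift (fst a) u)"
        using Cons.prems uv by (intro C generic_shift) (auto simp: generic_Cons generic_append)
    qed
  qed simp
  finally show ?thesis .
qed

lemma C_word_cong:
  assumes "generic w" and B: "\<And>v. generic v \<Longrightarrow> B v = B' v"
  shows "C_word B w = C_word B' w"
proof -
  have div_diff_cong: "div_diff F Z = div_diff G Z" if "\<And>z. z \<in> Z \<Longrightarrow> F z = G z" for F G ::
      "'a \<Rightarrow> 'a" and Z
    using that by (simp add: div_diff_def)
  show ?thesis
    unfolding C_word_def
  proof (intro sum.cong refl arg_cong2[of _ _ _ _ "(-)"])
    fix r assume r: "r \<in> {1..<length w}"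
    show "div_diff (\<lambda>t. B (shift t (take (length w - r) (drop (r - 1) w))))
        (insert 0 (insert (fst (last w)) (set (take (r - 1) (map fst w))))) =
      div_diff (\<lambda>t. B' (shift t (take (length w - r) (drop (r - 1) w))))
        (insert 0 (insert (fst (last w)) (set (take (r - 1) (map fst w)))))"
      by (rule div_diff_cong, rule B, rule generic_nodes(1)[OF assms(1)]) (use r in simp_all)
    show "div_diff (\<lambda>t. B (shift t (drop r w))) (insert 0 (set (take r (map fst w)))) =
      div_diff (\<lambda>t. B' (shift t (drop r w))) (insert 0 (set (take r (map fst w))))"
      by (rule div_diff_cong, rule B, rule generic_nodes(3)[OF assms(1)])
  qed
qed

definition preari_word :: "('k word \<Rightarrow> 'k) \<Rightarrow> ('k word \<Rightarrow> 'k) \<Rightarrow> 'k word \<Rightarrow> 'k::field" where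
  "preari_word A B w = block_der (amit_ker B) A w - block_der (anit_ker B) A w +
      deconc (\<lambda>u v. A u * B v) w"

lemma preari_word_cong:
  assumes "generic w" "\<And>v. generic v \<Longrightarrow> A v = A' v" "\<And>v. generic v \<Longrightarrow> B v = B' v"
  shows "preari_word A B w = preari_word A' B' w"
proof -
  have "deconc (\<lambda>u v. A u * B v) w = deconc (\<lambda>u v. A' u * B' v) w"
    using assms by (intro deconc_cong arg_cong2[of _ _ _ _ "(*)"]) (auto simp: generic_append)
  then show ?thesis
    unfolding preari_word_def using assms
    by (simp add: block_der_amit_ker_cong[of w A A' B B'] block_der_anit_ker_cong[of w A A' B B'])
qed

lemma natural_preari_word: "natural A \<Longrightarrow> natural B \<Longrightarrow> natural (preari_word A B)"
  unfolding preari_word_def[abs_def]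
  by (intro natural_add natural_diff natural_block_der_amit_ker natural_block_der_anit_ker
      natural_deconc)

text \<open>The \<open>mu\<close> part is multiplicativity of \<open>ganit\<^bsub>pic\<^esub>\<close>, the rest is the preceding theorem.
  Compared with the identity for bimoulds, \<open>ganit\<^bsub>pic\<^esub>\<close> of the arguments on the right takes the
  place of \<open>ganit\<^bsub>poc\<^esub>\<close> on the left.\<close>

theorem ganit_word_pic_preari_word:
  assumes "distinct (map fst w)" and "B [] = 0"
  shows "ganit_word pic_word (preari_word A B) w =
    preari_word (ganit_word pic_word A) (ganit_word pic_word B) w +
        block_der (anit_ker (C_word (ganit_word pic_word B))) (ganit_word pic_word A) w"
proof -
  have "preari_word A B = (\<lambda>w. block_der (arit_ker B) A w + deconc (\<lambda>u v. A u * B v) w)"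
    by (simp add: preari_word_def block_der_diff fun_eq_iff)
  then have "ganit_word pic_word (preari_word A B) w =
      ganit_word pic_word (block_der (arit_ker B) A) w +
          ganit_word pic_word (deconc (\<lambda>u v. A u * B v)) w"
    by (simp add: ganit_word_def block_aut_add)
  also have "ganit_word pic_word (deconc (\<lambda>u v. A u * B v)) w =
      deconc (\<lambda>u v. ganit_word pic_word A u * ganit_word pic_word B v) w"
    unfolding ganit_word_def block_aut_deconc block_aut_mult_left block_aut_mult_right ..
  also have "ganit_word pic_word (block_der (arit_ker B) A) w =
      block_der (amit_ker (ganit_word pic_word B)) (ganit_word pic_word A) w -
          block_der (anit_ker (ganit_word pic_word B)) (ganit_word pic_word A) w +
      block_der (anit_ker (C_word (ganit_word pic_word B))) (ganit_word pic_word A) w"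
    unfolding ganit_word_pic_arit[where A = A and B = B, OF assms] block_der_diff ..
  finally show ?thesis
    by (simp only: preari_word_def[of "ganit_word pic_word A"] ac_simps)
qed

lemma preari_letters: "B 0 = 0 \<Longrightarrow> preari A B r = preari_word (word_fun A) (word_fun B) (letters 1 r)"
  by (simp add: preari_def arit_def preari_word_def amit_letters anit_letters mu_letters)

lemma word_fun_pic: "generic w \<Longrightarrow> word_fun pic w = pic_word w" and regular_pic: "regular pic"
  using regularI[of pic pic_word] pic_letters natural_pic_word by auto

lemma word_fun_poc: "generic w \<Longrightarrow> word_fun poc w = poc_word w" and regular_poc: "regular poc"
  using regularI[of poc poc_word] poc_letters natural_poc_word by auto

lemma ganit_poc:
  assumes "regular A" "A 0 = 0"
  shows "regular (ganit poc A)" and "ganit poc A 0 = 0"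
    and "generic w \<Longrightarrow> word_fun (ganit poc A) w = ganit_word poc_word (word_fun A) w"
proof -
  have nat: "natural (ganit_word (word_fun poc) (word_fun A))"
    using assms by (intro natural_ganit_word natural_word_fun regular_poc)
  show "regular (ganit poc A)"
    by (rule regularI(1)[OF ganit_letters nat]) (rule assms)
  show "ganit poc A 0 = 0"
    using assms by (simp add: ganit_def)
  assume w: "generic w"
  then have "word_fun (ganit poc A) w = ganit_word (word_fun poc) (word_fun A) w"
    by (intro regularI(2)[OF ganit_letters nat] assms)
  also have "\<dots> = ganit_word poc_word (word_fun A) w"
    using w by (intro ganit_word_cong word_fun_poc) auto
  finally show "word_fun (ganit poc A) w = ganit_word poc_word (word_fun A) w" .
qed

lemma preari_regular:
  assumes "regular A" "regular B" "B 0 = 0"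
  shows "regular (preari A B)" and
      "generic w \<Longrightarrow> word_fun (preari A B) w = preari_word (word_fun A) (word_fun B) w"
  using regularI[of "preari A B" "preari_word (word_fun A) (word_fun B)"] assms
  by (simp_all add: preari_letters natural_preari_word natural_word_fun)

lemma Cmould_regular:
  assumes "regular B"
  shows "regular (Cmould B)" and "generic w \<Longrightarrow> word_fun (Cmould B) w = C_word (word_fun B) w"
  using regularI[of "Cmould B" "C_word (word_fun B)"] assms
  by (simp_all add: Cmould_letters natural_C_word natural_word_fun)

lemma preuri_letters:
  assumes "regular B" "B 0 = 0"
  shows "preuri A B r = preari_word (word_fun A) (word_fun B) (letters 1 r) +
    block_der (anit_ker (C_word (word_fun B))) (word_fun A) (letters 1 r)"
proof -
  have "anit (Cmould B) A r = block_der (anit_ker (word_fun (Cmould B))) (word_fun A) (letters 1 r)"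
    by (rule anit_letters) (simp add: Cmould_def)
  also have "\<dots> = block_der (anit_ker (C_word (word_fun B))) (word_fun A) (letters 1 r)"
    by (intro block_der_anit_ker_cong generic_letters Cmould_regular assms) auto
  finally show ?thesis
    by (simp add: preuri_def urit_def arit_def preari_word_def amit_letters anit_letters
        mu_letters assms)
qed

text \<open>Apply the identity on words to \<open>ganit\<^bsub>poc\<^esub>\<close> of the two bimoulds and cancel with
  \<open>ganit_word_pic_poc\<close>. All replacements take place at generic words, where both the operators on
  bimoulds and the inversion are available.\<close>

theorem ganit_pic_preari:
  assumes A: "regular A" "A 0 = 0" and B: "regular B" "B 0 = 0"
  shows "ganit pic (preari (ganit poc A) (ganit poc B)) r = preuri A B r"
proof -
  let ?A = "ganit_word poc_word (word_fun A)" and ?B = "ganit_word poc_word (word_fun B)" and ?w =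
      "letters 1 r"
  let ?E = "preari (ganit poc A) (ganit poc B)"
  have w: "generic ?w"
    by (simp add: generic_letters)
  have inv: "ganit_word pic_word (ganit_word poc_word F) v = F v" if "generic v" for F and v ::
      "ratfun word"
    using that by (intro ganit_word_pic_poc) (simp add: generic_def)
  have fmE: "word_fun ?E v = preari_word ?A ?B v" if v: "generic v" for v
  proof -
    have "word_fun ?E v = preari_word (word_fun (ganit poc A)) (word_fun (ganit poc B)) v"
      using v by (intro preari_regular ganit_poc A B)
    also have "\<dots> = preari_word ?A ?B v"
      using v by (intro preari_word_cong ganit_poc A B)
    finally show ?thesis .
  qed
  have "?E 0 = 0"
    using preari_letters[of "ganit poc B" "ganit poc A" 0] ganit_poc(2)[OF B]
        word_fun_Nil[of "ganit poc B"]
    by (simp add: letters_def preari_word_def)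
  then have "ganit pic ?E r = ganit_word (word_fun pic) (word_fun ?E) ?w"
    by (rule ganit_letters)
  also have "\<dots> = ganit_word pic_word (preari_word ?A ?B) ?w"
    by (intro ganit_word_cong w fmE word_fun_pic)
  also have "\<dots> = preari_word (ganit_word pic_word ?A) (ganit_word pic_word ?B) ?w +
      block_der (anit_ker (C_word (ganit_word pic_word ?B))) (ganit_word pic_word ?A) ?w"
    using w word_fun_Nil[of B] B by (intro ganit_word_pic_preari_word) (simp_all add: generic_def)
  also have "preari_word (ganit_word pic_word ?A) (ganit_word pic_word ?B) ?w =
      preari_word (word_fun A) (word_fun B) ?w"
    by (intro preari_word_cong w inv)
  also have "block_der (anit_ker (C_word (ganit_word pic_word ?B))) (ganit_word pic_word ?A) ?w =
      block_der (anit_ker (C_word (word_fun B))) (word_fun A) ?w"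
    by (intro block_der_anit_ker_cong C_word_cong w inv)
  finally show ?thesis
    by (simp only: preuri_letters[OF B])
qed

section \<open>Polynomial bimoulds\<close>

lemma BARI_pol_regular:
  assumes "A \<in> BARI_pol"
  shows "regular A" and "A 0 = 0"
proof -
  show "regular A"
    unfolding regular_def
  proof (intro allI impI)
    fix w :: "ratfun word"
    obtain p where "A (length w) = rf_of_poly p"
      using assms by (simp add: BARI_pol_def) (metis (no_types))
    then have *: "specializes (list_subst (map fst w) (map snd w)) (A (length w))
        (psubst (list_subst (map fst w) (map snd w)) p)"
      by (simp add: specializes_of_poly)
    show "specializes (list_subst (map fst w) (map snd w)) (A (length w)) (word_fun A w)"
      using * rsubst_specializes[OF *] by (simp add: word_fun_def ev_def)
  qed
  show "A 0 = 0"
    using assms by (simp add: BARI_pol_def)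
qed

theorem proposition3p1:
  fixes A B :: bimould
  assumes "A \<in> BARI_pol" and "B \<in> BARI_pol"
  shows "ganit pic (preari (ganit poc A) (ganit poc B)) = preuri A B \<and>
         uri A B = (\<lambda>r. preuri A B r - preuri B A r)"
proof
  note A = BARI_pol_regular[OF assms(1)] and B = BARI_pol_regular[OF assms(2)]
  let ?A = "ganit poc A" and ?B = "ganit poc B"
  note A' = ganit_poc(1,2)[OF A] and B' = ganit_poc(1,2)[OF B]
  show "ganit pic (preari ?A ?B) = preuri A B"
    using ganit_pic_preari[OF A B] by blast
  show "uri A B = (\<lambda>r. preuri A B r - preuri B A r)"
  proof
    fix r
    let ?F = "preari_word (word_fun ?A) (word_fun ?B)" and ?G =
        "preari_word (word_fun ?B) (word_fun ?A)" and ?w = "letters 1 r"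
    have preari_0: "preari ?A ?B 0 = 0" "preari ?B ?A 0 = 0"
      using A' B' word_fun_Nil by (simp_all add: preari_letters letters_def preari_word_def)
    have word_fun_ari: "word_fun (ari ?A ?B) v = word_fun (preari ?A ?B) v -
        word_fun (preari ?B ?A) v" if "generic v" for v
    proof -
      have "word_fun (ari ?A ?B) v = ?F v - ?G v"
        using that A' B'
        by (intro regularI(2) natural_diff natural_preari_word natural_word_fun)
          (simp_all add: ari_def preari_letters)
      then show ?thesis
        using that by (simp add: preari_regular A' B')
    qed
    have "uri A B r = ganit_word (word_fun pic) (word_fun (ari ?A ?B)) ?w"
      unfolding uri_def by (rule ganit_letters) (simp add: ari_def preari_0)
    also have "\<dots> = ganit_word (word_fun pic)
        (\<lambda>v. word_fun (preari ?A ?B) v - word_fun (preari ?B ?A) v) ?w"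
      by (intro ganit_word_cong generic_letters word_fun_ari) auto
    also have "\<dots> = ganit pic (preari ?A ?B) r - ganit pic (preari ?B ?A) r"
      by (simp add: ganit_letters[where A = "preari ?A ?B", OF preari_0(1)]
          ganit_letters[where A = "preari ?B ?A", OF preari_0(2)] ganit_word_def block_aut_diff)
    finally show "uri A B r = preuri A B r - preuri B A r"
      by (simp add: ganit_pic_preari[OF A B] ganit_pic_preari[OF B A])
  qed
qed

end
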